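(* Let $K\neq\mathbb{Q}(\sqrt{-3})$ be an imaginary quadratic field of discriminant $\Delta$ and let $\mathcal{P}$ be a $K$-Apollonian packing. Then the reduced curvatures of the circles of $\mathcal{P}$ have no common factor (their greatest common divisor is $1$).
   Context: Circles in $\widehat{\mathbb{C}}$ include lines. A $K$-Bianchi circle is $M(\widehat{\mathbb{R}})$, $M\in\mathrm{PSL}_2(\mathcal{O}_K)$ acting by Möbius transformations. An oriented circle has interior to the left of its direction of travel; its curvature is $\pm1/\text{radius}$ with sign $+$ for counterclockwise orientation and $-$ for clockwise, and $0$ for lines. The curvature of an oriented $K$-Bianchi circle is an integer multiple $n\sqrt{-\Delta}$, and $n\in\mathbb{Z}$ is its reduced curvature. A collection of circles straddles an oriented circle $C$ if it meets both the interior and exterior of $C$; it is tangency-connected if its tangency graph is connected. A $K$-Apollonian packing is a maximal tangency-connected set of oriented $K$-Bianchi circles with pairwise disjoint interiors that straddles no oriented $K$-Bianchi circle. *)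

theory Defs
  imports "HOL-Analysis.Analysis" "HOL-Computational_Algebra.Computational_Algebra"
begin

definition quadratic_field :: "int \<Rightarrow> complex set" where
  "quadratic_field d = {of_rat a + of_rat b * csqrt (of_int d) | a b. True}"

definition imaginary_quadratic_field :: "complex set \<Rightarrow> bool" where
  "imaginary_quadratic_field K \<longleftrightarrow> (\<exists>d<0. K = quadratic_field d)"

definition ring_of_integers :: "complex set \<Rightarrow> complex set" where
  "ring_of_integers K = {z \<in> K. algebraic_int z}"

text \<open>
  The squared determinant of the embeddings on an integral basis. For an imaginary quadratic
  field the two embeddings are the inclusion into the complex numbers and its conjugate; the
  value does not depend on the basis.
\<close>
definition discriminant :: "complex set \<Rightarrow> int" where
  "discriminant K = (THE D. \<exists>w\<^sub>1 w\<^sub>2.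
     ring_of_integers K = {of_int m * w\<^sub>1 + of_int n * w\<^sub>2 | m n. True} \<and>
     of_int D = (w\<^sub>1 * cnj w\<^sub>2 - w\<^sub>2 * cnj w\<^sub>1)\<^sup>2)"

text \<open>The Riemann sphere is the type \<^typ>\<open>complex option\<close>, with \<^term>\<open>None\<close> as the point at infinity.\<close>

fun moebius_action :: "complex^2^2 \<Rightarrow> complex option \<Rightarrow> complex option" where
  "moebius_action A None =
     (if A $ 2 $ 1 = 0 then None else Some (A $ 1 $ 1 / A $ 2 $ 1))"
| "moebius_action A (Some z) =
     (if A $ 2 $ 1 * z + A $ 2 $ 2 = 0 then None
      else Some (moebius (A $ 1 $ 1) (A $ 1 $ 2) (A $ 2 $ 1) (A $ 2 $ 2) z))"

definition extended_reals :: "complex option set" where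
  "extended_reals = insert None (Some ` \<real>)"

text \<open>A matrix and its negative act alike, so \<open>SL\<^sub>2\<close> and \<open>PSL\<^sub>2\<close> give the same circles.\<close>
definition SL2_integers :: "complex set \<Rightarrow> (complex^2^2) set" where
  "SL2_integers K = {A. (\<forall>i j. A $ i $ j \<in> ring_of_integers K) \<and> det A = 1}"

definition bianchi_circles :: "complex set \<Rightarrow> complex option set set" where
  "bianchi_circles K = {moebius_action A ` extended_reals | A. A \<in> SL2_integers K}"

datatype orientation = Counterclockwise | Clockwise

text \<open>
  \<open>Circle c r s\<close> has centre \<open>c\<close>, radius \<open>r\<close> and is traversed in the sense \<open>s\<close>.
  \<open>Line u h\<close> is traversed in the direction of the unit vector \<open>u\<close>; since \<open>cnj u\<close> rotates \<open>u\<close>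
  to \<open>1\<close>, it is the line at signed height \<open>h\<close> to the left of the parallel line through \<open>0\<close>.
  Subject to \<open>wf_ocircle\<close>, each oriented circle has exactly one such representation.
\<close>
datatype ocircle = Circle complex real orientation | Line complex real

fun wf_ocircle :: "ocircle \<Rightarrow> bool" where
  "wf_ocircle (Circle c r s) \<longleftrightarrow> r > 0"
| "wf_ocircle (Line u h) \<longleftrightarrow> norm u = 1"

fun points :: "ocircle \<Rightarrow> complex option set" where
  "points (Circle c r s) = Some ` sphere c r"
| "points (Line u h) = insert None (Some ` {z. Im (cnj u * z) = h})"

text \<open>The side to the left of the direction of travel.\<close>
fun oc_interior :: "ocircle \<Rightarrow> complex option set" where
  "oc_interior (Circle c r Counterclockwise) = Some ` ball c r"
| "oc_interior (Circle c r Clockwise) = - (Some ` cball c r)"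
| "oc_interior (Line u h) = Some ` {z. Im (cnj u * z) > h}"

definition oc_exterior :: "ocircle \<Rightarrow> complex option set" where
  "oc_exterior C = - (points C \<union> oc_interior C)"

fun curvature :: "ocircle \<Rightarrow> real" where
  "curvature (Circle c r Counterclockwise) = 1 / r"
| "curvature (Circle c r Clockwise) = - (1 / r)"
| "curvature (Line u h) = 0"

definition oriented_bianchi_circles :: "complex set \<Rightarrow> ocircle set" where
  "oriented_bianchi_circles K = {C. wf_ocircle C \<and> points C \<in> bianchi_circles K}"

definition reduced_curvature :: "int \<Rightarrow> ocircle \<Rightarrow> int" where
  "reduced_curvature \<Delta> C = (THE n. curvature C = of_int n * sqrt (- of_int \<Delta>))"

text \<open>
  Tangency takes place in the Riemann sphere, so parallel lines are tangent at infinity. The two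
  orientations of one circle are not tangent to each other.
\<close>
definition tangent :: "ocircle \<Rightarrow> ocircle \<Rightarrow> bool" where
  "tangent C D \<longleftrightarrow> (\<exists>p. points C \<inter> points D = {p})"

definition tangency_connected :: "ocircle set \<Rightarrow> bool" where
  "tangency_connected P \<longleftrightarrow>
     (\<forall>C\<in>P. \<forall>D\<in>P. (C, D) \<in> {(X, Y). X \<in> P \<and> Y \<in> P \<and> tangent X Y}\<^sup>*)"

definition straddles :: "ocircle set \<Rightarrow> ocircle \<Rightarrow> bool" where
  "straddles P C \<longleftrightarrow>
     (\<Union>D\<in>P. points D) \<inter> oc_interior C \<noteq> {} \<and> (\<Union>D\<in>P. points D) \<inter> oc_exterior C \<noteq> {}"

definition admissible :: "complex set \<Rightarrow> ocircle set \<Rightarrow> bool" where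
  "admissible K P \<longleftrightarrow>
     P \<subseteq> oriented_bianchi_circles K \<and>
     tangency_connected P \<and>
     pairwise (\<lambda>C D. oc_interior C \<inter> oc_interior D = {}) P \<and>
     (\<forall>C\<in>oriented_bianchi_circles K. \<not> straddles P C)"

definition apollonian_packing :: "complex set \<Rightarrow> ocircle set \<Rightarrow> bool" where
  "apollonian_packing K P \<longleftrightarrow>
     admissible K P \<and> (\<forall>Q. admissible K Q \<and> P \<subseteq> Q \<longrightarrow> Q = P)"

end

(* Around a circle C = M(R) of the packing, with M = (a, b; c, e), the neighbour C' tangent to C at
   M(infinity) satisfies n(C) + n(C') = |c|^2 for the reduced curvatures n. Bianchi circles do not
   cross and parallel Bianchi lines have quantised heights, so no Bianchi circle separates C from
   C', and maximality puts C' into the packing. Doing this at M(infinity), M(0) and M(1) shows that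
   a common factor g divides |c|^2, |e|^2 and |c + e|^2. Then e * cnj c / g is an algebraic integer,
   and expanding |a e - b c|^2 = 1 gives g | 1. *)

theory Submission
  imports Defs
begin


section \<open>The ring of integers\<close>

text \<open>Every oriented circle is encoded as a Hermitian form of determinant -1 in homogeneous
  coordinates, so that interior, circle and exterior become signs and infinity needs no separate
  treatment. Such forms pull back along \<open>SL2_integers K\<close>, which turns \<open>C\<close>
  into the real line and its neighbour into a parallel line at distance \<open>h\<close>, the least
  positive imaginary part in the ring of integers. Values of Bianchi forms at integral vectors lie
  in \<open>2 * h\<close> times the integers; this one fact quantises both heights and curvatures.
  The excluded field matters for non-crossing: a primitive cube root of unity on the diagonal
  rotates the real line to a Bianchi line crossing it. Two obstacles shape the last section: the
  enlarged collection must still straddle no oriented Bianchi circle, and disjoint interiors alone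
  do not forbid both orientations of one circle. Three points of tangency are used because the norms
  of \<open>c\<close> and \<open>e\<close> control only the norm of \<open>e * cnj c\<close>; the
  norm of \<open>c + e\<close> supplies its trace.\<close>

abbreviation int_poly_eval :: "int poly \<Rightarrow> complex \<Rightarrow> complex" where
  "int_poly_eval p z \<equiv> poly (map_poly of_int p) z"

lemma int_poly_eval_add: "int_poly_eval (p + q) z = int_poly_eval p z + int_poly_eval q z"
proof -
  have "map_poly of_int (p + q) = map_poly complex_of_int p + map_poly of_int q"
    by (intro poly_eqI) (simp add: coeff_map_poly)
  then show ?thesis by simp
qed

lemma int_poly_eval_smult: "int_poly_eval (smult c p) z = of_int c * int_poly_eval p z"
proof -
  have "map_poly of_int (smult c p) = smult (complex_of_int c) (map_poly of_int p)"
    by (intro poly_eqI) (simp add: coeff_map_poly)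
  then show ?thesis by simp
qed

lemma int_poly_eval_mult: "int_poly_eval (p * q) z = int_poly_eval p z * int_poly_eval q z"
  by (induction p)
    (simp_all add: int_poly_eval_add int_poly_eval_smult map_poly_pCons algebra_simps)

text \<open>Gauss's lemma. A non-real number is no root of a nonzero integer polynomial of degree
  below 2, so pseudo-division of a monic integer polynomial \<open>p\<close> with root
  \<open>z\<close> by \<open>q\<close> leaves no remainder. Comparing contents removes the
  pseudo-division factor \<open>k\<close>, and \<open>q\<close> divides \<open>p\<close> over the
  integers.\<close>

lemma lead_coeff_dvd_1_if_primitive_quadratic:
  fixes z :: complex and q :: "int poly"
  assumes z: "algebraic_int z" "Im z \<noteq> 0"
    and q: "degree q = 2" "content q = 1" "int_poly_eval q z = 0"
  shows "lead_coeff q dvd 1"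
proof -
  obtain p :: "int poly" where p: "lead_coeff p = 1" "int_poly_eval p z = 0"
    using z(1) unfolding algebraic_int_altdef_ipoly by auto
  have lin: "r = 0" if "degree r < 2" "int_poly_eval r z = 0" for r :: "int poly"
  proof -
    obtain u t where r: "r = pCons u t" by (cases r)
    with that(1) have "degree t = 0" by (cases "t = 0") auto
    then obtain v where r: "r = [:u, v:]"
      using r by (auto elim: degree_eq_zeroE)
    have "complex_of_int u + z * of_int v = 0"
      using that(2) r by (simp add: map_poly_pCons algebra_simps)
    then have "Im z * of_int v = 0" "of_int u + Re z * of_int v = 0"
      by (auto simp: complex_eq_iff)
    then show ?thesis using z(2) r by simp
  qed
  obtain s r where sr: "pseudo_divmod p q = (s, r)" by fastforce
  have q0: "q \<noteq> 0" using q(1) by auto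
  define k where "k = lead_coeff q ^ (Suc (degree p) - degree q)"
  have k0: "k \<noteq> 0" using q0 by (simp add: k_def)
  have 1: "smult k p = q * s + r" "r = 0 \<or> degree r < degree q"
    using pseudo_divmod[OF q0 sr] by (auto simp: k_def)
  have "int_poly_eval (q * s + r) z = 0"
    unfolding 1(1)[symmetric] using p by (simp add: int_poly_eval_smult)
  then have "int_poly_eval r z = 0"
    using q by (simp add: int_poly_eval_add int_poly_eval_mult)
  then have "r = 0" using lin 1(2) q(1) by (cases "r = 0") auto
  then have 2: "smult k p = q * s" using 1 by simp
  have "content p dvd 1" using content_dvd_coeff[of p "degree p"] p(1) by simp
  then have "content p = 1"
    by (metis content_1 dvd_0_left_iff is_unit_content_iff normalize_content one_neq_zero)
  then have "content s = normalize k"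
    using arg_cong[OF 2, of content] q(2) by (simp add: content_mult)
  then obtain j where "content s = k * j" by (metis dvdE dvd_normalize_iff dvd_refl)
  then have "s = smult k (smult j (primitive_part s))"
    by (metis content_times_primitive_part smult_smult)
  then obtain s' where s': "s = smult k s'" by blast
  have "smult k p = smult k (q * s')" using 2 s' by simp
  then have "p = q * s'" using k0 by (intro poly_eqI) (metis coeff_smult mult_left_cancel)
  then show ?thesis using p(1) by (metis dvd_triv_left lead_coeff_mult)
qed

lemma of_rat_complex: "(of_rat q :: complex) = of_real (of_rat q)"
  by (cases q) (simp add: of_rat_rat)

lemma complex_Rats_if: "Im z = 0 \<Longrightarrow> Re z \<in> \<rat> \<Longrightarrow> z \<in> \<rat>"
  by (elim Rats_cases) (metis Rats_of_rat complex_eq_iff complex.sel of_rat_complex Re_complex_of_real Im_complex_of_real)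

lemma real_Rats_eq_frac:
  assumes "(u::real) \<in> \<rat>" "v \<in> \<rat>"
  obtains e f c :: int where "c > 0" "u = of_int e / of_int c" "v = of_int f / of_int c"
proof -
  obtain e c where 1: "c > 0" "u = of_int e / of_int c"
    using assms(1) by (metis Rats_cases')
  obtain f b where 2: "b > 0" "v = of_int f / of_int b"
    using assms(2) by (metis Rats_cases')
  show ?thesis
    using 1 2 by (intro that[of "c * b" "e * b" "f * c"]) auto
qed

lemma real_Rats_monic_quadratic_root:
  assumes "x \<in> \<rat>" "m \<in> \<int>" "n \<in> \<int>" "x\<^sup>2 - m * x + n = (0::real)"
  shows "x \<in> \<int>"
proof -
  have "algebraic_int x"
    by (rule algebraic_int.intros[where p = "[:n, -m, 1:]"])
      (use assms in \<open>auto simp: coeff_pCons power2_eq_square algebra_simps split: nat.splits\<close>)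
  with assms(1) show ?thesis by (rule rational_algebraic_int_is_int[rotated])
qed

lemma cmod_square_mult: "(cmod (z * w))\<^sup>2 = (cmod z)\<^sup>2 * (cmod w)\<^sup>2"
  by (simp add: norm_mult power_mult_distrib)

text \<open>\<open>d\<close> is any negative integer, possibly with square factors, so an explicit
  integral basis in terms of \<open>d\<close> is not at hand. The ring is described instead by trace
  and norm (\<open>O_iff\<close>) and by an element of least positive imaginary part.\<close>

locale imaginary_quadratic =
  fixes d :: int and K :: "complex set"
  assumes d: "d < 0" and K: "K = quadratic_field d"
begin

abbreviation \<O> :: "complex set" where "\<O> \<equiv> ring_of_integers K"

definition r :: real where "r = sqrt (- of_int d)"

lemma r_pos: "r > 0" and r_sq: "r\<^sup>2 = - of_int d"
  using d by (auto simp: r_def)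

lemma csqrt_d: "csqrt (of_int d) = Complex 0 r"
  using d csqrt_of_real_nonpos[of "of_int d"] by (simp add: r_def complex_eq_iff)

lemma K_iff: "z \<in> K \<longleftrightarrow> Re z \<in> \<rat> \<and> Im z / r \<in> \<rat>"
proof
  assume "z \<in> K"
  then obtain a b where "z = of_rat a + of_rat b * csqrt (of_int d)"
    by (auto simp: K quadratic_field_def)
  then have "Re z = of_rat a" "Im z / r = of_rat b"
    using r_pos by (auto simp: csqrt_d of_rat_complex)
  then show "Re z \<in> \<rat> \<and> Im z / r \<in> \<rat>" by simp
next
  assume "Re z \<in> \<rat> \<and> Im z / r \<in> \<rat>"
  then obtain a b where "Re z = of_rat a" "Im z / r = of_rat b"
    by (auto elim!: Rats_cases)
  then have "z = of_rat a + of_rat b * csqrt (of_int d)"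
    using r_pos by (auto simp: csqrt_d of_rat_complex complex_eq_iff field_simps)
  then show "z \<in> K" by (auto simp: K quadratic_field_def)
qed

lemma r_mult_cancel: "x / r * (y / r) * r\<^sup>2 = x * y"
  using r_pos by (simp add: power2_eq_square)

lemma r_sq_Rats: "r\<^sup>2 \<in> \<rat>"
  by (simp add: r_sq)

lemma Im_mult_Rats: "z \<in> K \<Longrightarrow> w \<in> K \<Longrightarrow> Im z * Im w \<in> \<rat>"
  by (metis K_iff Rats_mult r_mult_cancel r_sq_Rats)

lemma K_mult: "z \<in> K \<Longrightarrow> w \<in> K \<Longrightarrow> z * w \<in> K"
proof -
  assume z: "z \<in> K" "w \<in> K"
  have "Im (z * w) / r = Re z * (Im w / r) + (Im z / r) * Re w"
    by (simp add: add_divide_distrib)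
  then show ?thesis
    using z Im_mult_Rats[OF z] by (simp add: K_iff Rats_add Rats_mult Rats_diff del: times_divide_eq_left times_divide_eq_right)
qed

lemma K_add: "z \<in> K \<Longrightarrow> w \<in> K \<Longrightarrow> z + w \<in> K"
  by (auto simp: K_iff add_divide_distrib)

lemma K_cnj: "z \<in> K \<Longrightarrow> cnj z \<in> K"
  by (auto simp: K_iff)

lemma norm_Rats: "z \<in> K \<Longrightarrow> (cmod z)\<^sup>2 \<in> \<rat>"
  unfolding cmod_power2 using Im_mult_Rats[of z z] by (auto simp: K_iff power2_eq_square)

text \<open>The monic quadratic satisfied by \<open>z\<close> has the trace and the norm as
  coefficients. For non-real \<open>z\<close>, clear denominators and divide by the content: Gauss's
  lemma makes the leading coefficient a unit, so the common denominator divides both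
  numerators.\<close>

lemma O_iff: "z \<in> \<O> \<longleftrightarrow> z \<in> K \<and> 2 * Re z \<in> \<int> \<and> (cmod z)\<^sup>2 \<in> \<int>"
proof
  assume "z \<in> \<O>"
  then have z: "z \<in> K" "algebraic_int z" by (auto simp: ring_of_integers_def)
  show "z \<in> K \<and> 2 * Re z \<in> \<int> \<and> (cmod z)\<^sup>2 \<in> \<int>"
  proof (cases "Im z = 0")
    case True
    then have "z \<in> \<rat>" using z K_iff complex_Rats_if by blast
    then have "z \<in> \<int>" using z(2) rational_algebraic_int_is_int by blast
    then show ?thesis using z(1) by (auto elim!: Ints_cases)
  next
    case False
    have "2 * Re z \<in> \<rat>" using z K_iff by simp
    then obtain e f c where efc: "c > 0" "2 * Re z = of_int e / of_int c"
      "(cmod z)\<^sup>2 = of_int f / of_int c"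
      using norm_Rats[OF z(1)] real_Rats_eq_frac by metis 
    define q0 where "q0 = [:f, -e, c:]"
    define q where "q = primitive_part q0"
    define g where "g = content q0"
    have q0: "q0 = smult g q" by (simp add: q_def g_def)
    have g0: "g \<noteq> 0" using efc(1) by (auto simp: g_def q0_def)
    have "of_int f - of_int e * z + of_int c * z\<^sup>2 = of_int c * (z\<^sup>2 - of_real (2 * Re z) * z + of_real ((cmod z)\<^sup>2))"
      unfolding efc(2,3) using efc(1) by (simp add: field_simps)
    also have "z\<^sup>2 - of_real (2 * Re z) * z + of_real ((cmod z)\<^sup>2) = 0"
      unfolding cmod_power2 by (simp add: complex_eq_iff power2_eq_square algebra_simps)
    finally have "int_poly_eval q0 z = 0"
      by (simp add: q0_def map_poly_pCons power2_eq_square algebra_simps)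
    then have "int_poly_eval q z = 0" using g0 by (simp add: q0 int_poly_eval_smult)
    moreover have dq: "degree q = 2" using efc(1) by (simp add: q_def q0_def)
    moreover have "content q = 1" using g0 by (simp add: q_def g_def)
    ultimately have "lead_coeff q dvd 1"
      using lead_coeff_dvd_1_if_primitive_quadratic[OF z(2) False] by blast
    then have l: "\<bar>coeff q 2\<bar> = 1" using dq by simp
    have *: "coeff q0 i = g * coeff q i" for i by (simp add: q0)
    have "c = g * coeff q 2" "-e = g * coeff q 1" "f = g * coeff q 0"
      using *[of 2] *[of 1] *[of 0] by (simp_all add: q0_def numeral_2_eq_2)
    moreover have "coeff q 2 = 1 \<or> coeff q 2 = -1" using l by linarith
    ultimately have "e = c * (- coeff q 1 * coeff q 2)" "f = c * (coeff q 0 * coeff q 2)"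
      by auto
    then have "2 * Re z = of_int (- coeff q 1 * coeff q 2)" "(cmod z)\<^sup>2 = of_int (coeff q 0 * coeff q 2)"
      using efc(1) unfolding efc(2,3) by simp_all
    then show ?thesis using z(1) by (metis Ints_of_int)
  qed
next
  assume z: "z \<in> K \<and> 2 * Re z \<in> \<int> \<and> (cmod z)\<^sup>2 \<in> \<int>"
  then obtain m n where mn: "2 * Re z = of_int m" "(cmod z)\<^sup>2 = of_int n"
    by (auto elim!: Ints_cases)
  have "z\<^sup>2 - of_real (2 * Re z) * z + of_real ((cmod z)\<^sup>2) = 0"
    unfolding cmod_power2 by (simp add: complex_eq_iff power2_eq_square algebra_simps)
  then have "algebraic_int z" unfolding mn
    by (intro algebraic_int.intros[where p = "[:of_int n, - of_int m, 1:]"])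
      (auto simp: coeff_pCons power2_eq_square algebra_simps split: nat.splits)
  then show "z \<in> \<O>" using z by (simp add: ring_of_integers_def)
qed

text \<open>The norm is multiplicative, so only the trace is at issue. The traces of
  \<open>z * w\<close> and \<open>z * cnj w\<close> have integral sum and integral product; being
  rational and a root of a monic integer quadratic, the first is an integer.\<close>

lemma O_mult: assumes "z \<in> \<O>" "w \<in> \<O>" shows "z * w \<in> \<O>"
proof -
  have zw: "z \<in> K" "w \<in> K" "2 * Re z \<in> \<int>" "2 * Re w \<in> \<int>" "(cmod z)\<^sup>2 \<in> \<int>" "(cmod w)\<^sup>2 \<in> \<int>"
    using assms O_iff by auto
  define x y where "x = 2 * Re (z * w)" and "y = 2 * Re (z * cnj w)"
  have "x \<in> \<rat>" using K_mult[OF zw(1,2)] unfolding x_def K_iff by (metis Rats_mult Rats_number_of)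
  moreover have "x + y = (2 * Re z) * (2 * Re w)" by (simp add: x_def y_def)
  then have "x + y \<in> \<int>" using zw by (metis Ints_mult)
  moreover have "x * y = (cmod w)\<^sup>2 * ((2 * Re z)\<^sup>2 - 2 * (cmod z)\<^sup>2) + (cmod z)\<^sup>2 * ((2 * Re w)\<^sup>2 - 2 * (cmod w)\<^sup>2)"
    unfolding cmod_power2 by (simp add: x_def y_def power2_eq_square algebra_simps)
  then have "x * y \<in> \<int>" using zw by (metis Ints_add Ints_mult Ints_diff Ints_power Ints_numeral)
  moreover have "x\<^sup>2 - (x + y) * x + x * y = 0" by (simp add: power2_eq_square algebra_simps)
  ultimately have "x \<in> \<int>" by (rule real_Rats_monic_quadratic_root)
  then show ?thesis
    using zw K_mult by (simp add: O_iff x_def cmod_square_mult)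
qed

lemma O_cnj: "z \<in> \<O> \<Longrightarrow> cnj z \<in> \<O>"
  by (simp add: O_iff K_cnj)

lemma O_of_int: "of_int n \<in> \<O>"
  by (simp add: O_iff K_iff)

lemma O_0: "0 \<in> \<O>" and O_1: "1 \<in> \<O>" using O_of_int[of 0] O_of_int[of 1] by auto

lemma Re_O: "z \<in> \<O> \<Longrightarrow> 2 * Re z \<in> \<int>" and norm_O: "z \<in> \<O> \<Longrightarrow> (cmod z)\<^sup>2 \<in> \<int>"
  by (auto simp: O_iff)

text \<open>The cross term in the norm of the sum is the trace of \<open>z * cnj w\<close>, which is
  why closure under products comes before closure under sums.\<close>

lemma O_add: assumes "z \<in> \<O>" "w \<in> \<O>" shows "z + w \<in> \<O>"
proof -
  have "2 * Re (z * cnj w) \<in> \<int>" using O_mult[OF assms(1) O_cnj[OF assms(2)]] Re_O by blast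
  moreover have "(cmod (z + w))\<^sup>2 = (cmod z)\<^sup>2 + (cmod w)\<^sup>2 + 2 * Re (z * cnj w)"
    unfolding cmod_power2 by (simp add: power2_eq_square algebra_simps)
  ultimately show ?thesis using assms by (auto simp: O_iff K_add distrib_left)
qed

lemma O_uminus: "z \<in> \<O> \<Longrightarrow> - z \<in> \<O>"
  using O_mult[OF O_of_int[of "-1"]] by simp

lemma O_diff: "z \<in> \<O> \<Longrightarrow> w \<in> \<O> \<Longrightarrow> z - w \<in> \<O>"
  using O_add[OF _ O_uminus] by fastforce

lemmas O_intros = O_mult O_cnj O_0 O_1 O_of_int O_add O_diff O_uminus

lemma O_real: "z \<in> \<O> \<Longrightarrow> Im z = 0 \<Longrightarrow> z \<in> \<int>"
  using complex_Rats_if rational_algebraic_int_is_int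
  by (auto simp: ring_of_integers_def K_iff)

lemma integral_quotient:
  assumes "x \<in> \<O>" "g \<noteq> 0" "2 * Re x / of_int g \<in> \<int>" "(cmod x)\<^sup>2 / (of_int g)\<^sup>2 \<in> \<int>"
  shows "x / of_int g \<in> \<O>"
proof -
  have "x / of_int g = x * of_real (1 / of_int g)" by simp
  moreover have "of_real (1 / of_int g) \<in> K" by (simp add: K_iff)
  ultimately have "x / of_int g \<in> K" using K_mult assms(1) O_iff by metis
  then show ?thesis using assms by (simp add: O_iff norm_divide power_divide)
qed

text \<open>Integral closedness of the order replaces unique factorisation into prime ideals:
  the hypotheses make \<open>e * cnj c / g\<close> integral, so \<open>g\<close> divides every term in the expansion
  of \<open>\<bar>a * e - b * c\<bar>\<^sup>2 = 1\<close>.\<close>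
lemma bottom_row_norms_coprime:
  assumes "a \<in> \<O>" "b \<in> \<O>" "c \<in> \<O>" "e \<in> \<O>" and det: "a * e - b * c = 1"
    and g: "(cmod c)\<^sup>2 = of_int (g * k1)" "(cmod e)\<^sup>2 = of_int (g * k2)"
      "(cmod (c + e))\<^sup>2 = of_int (g * k3)"
  shows "g dvd 1"
proof (cases "g = 0")
  case True
  then show ?thesis using g det by simp
next
  case False
  define x where "x = e * cnj c / of_int g"
  \<comment> \<open>Polarisation: the three norms together make the trace of
    \<open>e * cnj c\<close> divisible by \<open>g\<close>, while its norm is divisible by the
    square of \<open>g\<close>.\<close>
  have "(cmod (c + e))\<^sup>2 = (cmod c)\<^sup>2 + (cmod e)\<^sup>2 + 2 * Re (e * cnj c)"
    unfolding cmod_power2 by (simp add: power2_eq_square algebra_simps)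
  then have "2 * Re (e * cnj c) = of_int (g * (k3 - k1 - k2))"
    using g by (simp add: algebra_simps)
  then have "2 * Re (e * cnj c) / of_int g = of_int (k3 - k1 - k2)" using False by (simp only:) simp
  moreover have "(cmod (e * cnj c))\<^sup>2 / (of_int g)\<^sup>2 = of_int (k1 * k2)"
    unfolding cmod_square_mult using g False by (simp add: power2_eq_square field_simps)
  ultimately have "x \<in> \<O>"
    unfolding x_def by (intro integral_quotient) (use assms False O_intros in \<open>auto simp del: of_int_diff of_int_mult\<close>)
  then have "2 * Re (a * cnj b * x) \<in> \<int>" using assms O_intros Re_O by metis
  then obtain k where k: "2 * Re (a * cnj b * x) = of_int k" by (auto elim: Ints_cases)
  obtain na nb where n: "(cmod a)\<^sup>2 = of_int na" "(cmod b)\<^sup>2 = of_int nb"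
    using assms norm_O by (metis Ints_cases)
  have "e * cnj c = of_int g * x" using False by (simp add: x_def)
  then have *: "Re (a * cnj b * (e * cnj c)) = of_int g * Re (a * cnj b * x)"
    by (simp add: algebra_simps)
  have "1 = (cmod (a * e - b * c))\<^sup>2" by (simp add: det)
  also have "\<dots> = (cmod a)\<^sup>2 * (cmod e)\<^sup>2 + (cmod b)\<^sup>2 * (cmod c)\<^sup>2 - 2 * Re (a * cnj b * (e * cnj c))"
    unfolding cmod_power2 by (simp add: power2_eq_square algebra_simps)
  also have "\<dots> = of_int (g * (na * k2 + nb * k1 - k))"
    unfolding * n g k[symmetric] of_int_mult of_int_diff of_int_add by (simp add: algebra_simps)
  finally have "1 = g * (na * k2 + nb * k1 - k)" by linarith
  then show ?thesis by (metis dvd_triv_left)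
qed

end

section \<open>Integral basis, discriminant, and the real binary forms attached to integral
  matrices\<close>

context imaginary_quadratic
begin

text \<open>\<open>(2 * Im z)\<^sup>2\<close> is four times the norm minus the squared trace, hence
  a natural number, so a least positive imaginary part exists. Division with nearest-integer
  quotient leaves an imaginary part of at most half the minimum, hence zero.\<close>

lemma ex_minimal_imaginary_part:
  "\<exists>w\<in>\<O>. Im w > 0 \<and> (\<forall>z\<in>\<O>. \<exists>k::int. Im z = of_int k * Im w)"
proof -
  have sq: "\<exists>n::nat. (2 * Im z)\<^sup>2 = of_nat n" if "z \<in> \<O>" for z
  proof -
    have "(2 * Im z)\<^sup>2 = 4 * (cmod z)\<^sup>2 - (2 * Re z)\<^sup>2"
      unfolding cmod_power2 by (simp add: power2_eq_square)
    also have "\<dots> \<in> \<int>" using norm_O[OF that] Re_O[OF that]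
      by (metis Ints_diff Ints_mult Ints_power Ints_numeral)
    finally obtain k :: int where k: "(2 * Im z)\<^sup>2 = of_int k" by (auto elim: Ints_cases)
    then have "k \<ge> 0" by (metis of_int_0_le_iff zero_le_power2)
    then show ?thesis using k by (metis nonneg_int_cases of_int_of_nat_eq)
  qed
  define Q where "Q n \<longleftrightarrow> (\<exists>w\<in>\<O>. Im w > 0 \<and> (2 * Im w)\<^sup>2 = of_nat n)" for n :: nat
  have "csqrt (of_int d) \<in> \<O>"
    using r_pos r_sq unfolding O_iff K_iff cmod_power2 by (simp add: csqrt_d)
  moreover have "Im (csqrt (of_int d)) > 0" using r_pos by (simp add: csqrt_d)
  ultimately have "\<exists>n. Q n" using sq unfolding Q_def by blast
  then obtain n where n: "Q n" "\<And>m. Q m \<Longrightarrow> n \<le> m" by (metis Least_le LeastI)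
  then obtain w where w: "w \<in> \<O>" "Im w > 0" "(2 * Im w)\<^sup>2 = of_nat n" unfolding Q_def by blast
  have min: "Im w \<le> Im u" if "u \<in> \<O>" "Im u > 0" for u
  proof -
    obtain m :: nat where m: "(2 * Im u)\<^sup>2 = of_nat m" using sq[OF \<open>u \<in> \<O>\<close>] by blast
    then have "n \<le> m" using that n(2) unfolding Q_def by blast
    then have "(2 * Im w)\<^sup>2 \<le> (2 * Im u)\<^sup>2" using m w(3) by simp
    then show ?thesis using that(2) by (simp add: power2_le_iff_abs_le)
  qed
  have "\<exists>k::int. Im z = of_int k * Im w" if z: "z \<in> \<O>" for z
  proof -
    define k where "k = round (Im z / Im w)"
    define u where "u = z - of_int k * w"
    have u: "u \<in> \<O>" using z w O_intros by (simp add: u_def)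
    have "\<bar>Im z / Im w - of_int k\<bar> \<le> 1/2"
      using of_int_round_abs_le[of "Im z / Im w"] by (simp add: k_def abs_minus_commute)
    moreover have "Im u = (Im z / Im w - of_int k) * Im w"
      using w(2) by (simp add: u_def field_simps)
    then have "\<bar>Im u\<bar> = \<bar>Im z / Im w - of_int k\<bar> * Im w" using w(2) by (simp add: abs_mult)
    ultimately have "\<bar>Im u\<bar> \<le> 1/2 * Im w" using w(2) by (metis mult_right_mono less_imp_le)
    then have "\<bar>Im u\<bar> < Im w" using w(2) by linarith
    then have "Im u = 0" using min[OF u] min[OF O_uminus[OF u]] by fastforce
    then show ?thesis by (auto simp: u_def)
  qed
  then show ?thesis using w by blast
qed

definition \<omega> :: complex where
  "\<omega> = (SOME w. w \<in> \<O> \<and> Im w > 0 \<and> (\<forall>z\<in>\<O>. \<exists>k::int. Im z = of_int k * Im w))"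

text \<open>By \<open>sqrt_discriminant\<close> below, \<open>2 * h\<close> is the unit in which reduced curvatures are measured.\<close>
definition h :: real where "h = Im \<omega>"

lemma omega_in_O: "\<omega> \<in> \<O>" and h_pos: "h > 0"
  and Im_O: "z \<in> \<O> \<Longrightarrow> \<exists>k::int. Im z = of_int k * h"
proof -
  have "\<omega> \<in> \<O> \<and> Im \<omega> > 0 \<and> (\<forall>z\<in>\<O>. \<exists>k::int. Im z = of_int k * Im \<omega>)"
    unfolding \<omega>_def by (rule someI_ex) (use ex_minimal_imaginary_part in blast)
  then show "\<omega> \<in> \<O>" "h > 0" "z \<in> \<O> \<Longrightarrow> \<exists>k::int. Im z = of_int k * h"
    unfolding h_def by auto
qed

lemma O_eq: "\<O> = {of_int m * 1 + of_int n * \<omega> | m n. True}"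
proof (intro equalityI subsetI)
  fix z assume z: "z \<in> \<O>"
  then obtain n :: int where n: "Im z = of_int n * h" using Im_O by blast
  have "z - of_int n * \<omega> \<in> \<O>" using z omega_in_O O_intros by simp
  then have "z - of_int n * \<omega> \<in> \<int>" using n by (intro O_real) (auto simp: h_def)
  then obtain m :: int where "z - of_int n * \<omega> = of_int m" by (auto elim: Ints_cases)
  then have "z = of_int m * 1 + of_int n * \<omega>" by (simp add: algebra_simps)
  then show "z \<in> {of_int m * 1 + of_int n * \<omega> | m n. True}" by blast
qed (use omega_in_O O_intros in auto)

text \<open>The definite description needs uniqueness over all bases. A basis \<open>u\<close>,
  \<open>v\<close> has \<open>Im (u * cnj v) = k * h\<close> for an integer \<open>k\<close>;
  expanding 1 and \<open>\<omega>\<close> in that basis shows that \<open>k\<close> divides 1, so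
  its square is 1.\<close>

lemma discriminant_eq: "of_int (discriminant K) = - (2 * h)\<^sup>2"
proof -
  have sq: "(u * cnj v - v * cnj u)\<^sup>2 = of_real (- (2 * Im (u * cnj v))\<^sup>2)" for u v
  proof -
    have "u * cnj v - v * cnj u = \<i> * of_real (2 * Im (u * cnj v))"
      by (simp add: complex_eq_iff algebra_simps)
    moreover have "(\<i> * complex_of_real y)\<^sup>2 = of_real (- y\<^sup>2)" for y
      by (simp add: power_mult_distrib)
    ultimately show ?thesis by (simp only:)
  qed
  define B where "B D \<longleftrightarrow> (\<exists>w\<^sub>1 w\<^sub>2.
     \<O> = {of_int m * w\<^sub>1 + of_int n * w\<^sub>2 | m n. True} \<and>
     of_int D = (w\<^sub>1 * cnj w\<^sub>2 - w\<^sub>2 * cnj w\<^sub>1)\<^sup>2)" for D :: int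
  obtain t n :: int where tn: "2 * Re \<omega> = of_int t" "(cmod \<omega>)\<^sup>2 = of_int n"
    using omega_in_O by (auto simp: O_iff elim!: Ints_cases)
  have "(2 * h)\<^sup>2 = 4 * (cmod \<omega>)\<^sup>2 - (2 * Re \<omega>)\<^sup>2"
    unfolding cmod_power2 h_def by (simp add: power2_eq_square)
  then have D0: "- (2 * h)\<^sup>2 = of_int (t\<^sup>2 - 4 * n)" by (simp add: tn)
  have Im1: "Im (1 * cnj \<omega>) = - h" by (simp add: h_def)
  have "of_int (t\<^sup>2 - 4 * n) = (1 * cnj \<omega> - \<omega> * cnj 1)\<^sup>2"
    unfolding sq Im1 using D0 by (metis of_real_of_int_eq power2_minus mult_minus_right)
  then have "B (t\<^sup>2 - 4 * n)" unfolding B_def using O_eq by blast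
  moreover have "D = t\<^sup>2 - 4 * n" if BD: "B D" for D
  proof -
    obtain u v where uv: "\<O> = {of_int m * u + of_int n * v | m n. True}"
      "of_int D = (u * cnj v - v * cnj u)\<^sup>2" using BD unfolding B_def by blast
    have "of_int D = complex_of_real (- (2 * Im (u * cnj v))\<^sup>2)" using uv(2) unfolding sq .
    then have D: "of_int D = - (2 * Im (u * cnj v))\<^sup>2"
      by (metis of_real_eq_iff of_real_of_int_eq)
    have "u = of_int 1 * u + of_int 0 * v" "v = of_int 0 * u + of_int 1 * v" by simp_all
    then have "u \<in> \<O>" "v \<in> \<O>" unfolding uv(1) by blast+
    then obtain k :: int where k: "Im (u * cnj v) = of_int k * h"
      using Im_O O_intros by metis
    obtain m n where mn: "1 = of_int m * u + of_int n * v" using O_1 unfolding uv(1) by auto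
    obtain m' n' where mn': "\<omega> = of_int m' * u + of_int n' * v"
      using omega_in_O unfolding uv(1) by auto
    have "h = Im (\<omega> * cnj 1)" by (simp add: h_def)
    also have "\<dots> = of_int (m' * n - n' * m) * Im (u * cnj v)"
      unfolding mn mn' by (simp add: algebra_simps)
    finally have "h * of_int ((m' * n - n' * m) * k) = h * 1" unfolding k by (simp add: mult_ac)
    then have "real_of_int ((m' * n - n' * m) * k) = 1" using h_pos by (simp only: mult_cancel_left) simp
    then have "(m' * n - n' * m) * k = 1" by linarith
    then have "k\<^sup>2 = 1" by (auto simp: zmult_eq_1_iff)
    then have "(real_of_int k)\<^sup>2 = 1" by (metis of_int_1 of_int_power)
    then have "of_int D = - (2 * h)\<^sup>2" unfolding D k by (simp add: power_mult_distrib)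
    then show ?thesis using D0 by linarith
  qed
  ultimately have "discriminant K = t\<^sup>2 - 4 * n"
    unfolding discriminant_def B_def[symmetric] by (intro the_equality)
  then show ?thesis using D0 by simp
qed

lemma sqrt_discriminant: "sqrt (- of_int (discriminant K)) = 2 * h"
proof -
  have "- of_int (discriminant K) = (2 * h)\<^sup>2" using discriminant_eq by simp
  from real_sqrt_unique[OF this[symmetric]] show ?thesis using h_pos by simp
qed

text \<open>The form is \<open>Im ((a * x + b * y) * cnj (c * x + e * y))\<close> for real \<open>x\<close>, \<open>y\<close>. With
  \<open>\<delta> = 4 * h\<^sup>2\<close>, minus the field discriminant, and \<open>\<kappa>\<close> the discriminant of the integral form, one
  has \<open>\<delta> * \<kappa> + T\<^sup>2 = 4\<close> for an integer \<open>T\<close>. A positive \<open>\<kappa>\<close> leaves only \<open>\<delta> = 3\<close>, the excluded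
  field, and \<open>\<delta> = 4\<close> with \<open>T = 0\<close>, which parity rules out over the Gaussian integers.\<close>
lemma binary_form_semidefinite:
  assumes K3: "K \<noteq> quadratic_field (- 3)"
    and O: "a \<in> \<O>" "b \<in> \<O>" "c \<in> \<O>" "e \<in> \<O>" and det: "a * e - b * c = 1"
  shows "(Im (a * cnj e + b * cnj c))\<^sup>2 \<le> 4 * Im (a * cnj c) * Im (b * cnj e)"
proof (rule ccontr)
  assume neg: "\<not> ?thesis"
  obtain k m l :: int where k: "Im (a * cnj c) = of_int k * h"
    "Im (a * cnj e + b * cnj c) = of_int m * h" "Im (b * cnj e) = of_int l * h"
    using O Im_O O_intros by metis
  have "2 * Re (a * cnj e - b * cnj c) \<in> \<int>" using O Re_O O_intros by metis
  then obtain T where T: "2 * Re (a * cnj e - b * cnj c) = of_int T" by (auto elim: Ints_cases)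
  obtain t n :: int where tn: "2 * Re \<omega> = of_int t" "(cmod \<omega>)\<^sup>2 = of_int n"
    using omega_in_O by (auto simp: O_iff elim!: Ints_cases)
  \<comment> \<open>Since \<open>t\<^sup>2\<close> is 0 or 1 modulo 4, \<open>\<delta>\<close> is 0
    or 3 modulo 4; with \<open>0 < \<delta>\<close> and \<open>\<delta> \<le> 4\<close> this is what
    leaves 3 and 4.\<close>
  define \<delta> where "\<delta> = 4 * n - t\<^sup>2"
  have \<delta>: "of_int \<delta> = 4 * h\<^sup>2"
    using tn[symmetric] unfolding cmod_power2 \<delta>_def h_def by (simp add: power2_eq_square)
  define \<kappa> where "\<kappa> = m\<^sup>2 - 4 * k * l"
  \<comment> \<open>The substitution multiplies the determinant of the Hermitian form
    \<open>2 * Im (x * cnj y)\<close> by the squared modulus of \<open>a * e - b * c\<close>; the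
    first and last squares are those of the real and imaginary parts of the new off-diagonal
    entry.\<close>
  have "(Im (a * cnj e + b * cnj c))\<^sup>2 - 4 * Im (a * cnj c) * Im (b * cnj e) + (Re (a * cnj e - b * cnj c))\<^sup>2
    = (cmod (a * e - b * c))\<^sup>2"
    unfolding cmod_power2 by (simp add: power2_eq_square algebra_simps)
  then have id: "(Im (a * cnj e + b * cnj c))\<^sup>2 - 4 * Im (a * cnj c) * Im (b * cnj e) + (Re (a * cnj e - b * cnj c))\<^sup>2 = 1"
    by (simp add: det)
  have hk: "(Im (a * cnj e + b * cnj c))\<^sup>2 - 4 * Im (a * cnj c) * Im (b * cnj e) = h\<^sup>2 * of_int \<kappa>"
    unfolding k \<kappa>_def by (simp add: power2_eq_square algebra_simps)
  have ReT: "Re (a * cnj e - b * cnj c) = of_int T / 2" using T by simp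
  have "h\<^sup>2 * of_int \<kappa> + (of_int T / 2)\<^sup>2 = 1" using id unfolding hk ReT .
  then have "real_of_int (\<delta> * \<kappa> + T\<^sup>2) = 4" using \<delta> by (simp add: power_divide)
  then have eq: "\<delta> * \<kappa> + T\<^sup>2 = 4" by linarith
  have "h\<^sup>2 * of_int \<kappa> > 0" using neg hk by linarith
  then have "\<kappa> > 0" using h_pos by (simp add: zero_less_mult_iff)
  have "\<delta> > 0" using \<delta> h_pos by (metis of_int_0_less_iff zero_less_power mult_pos_pos zero_less_numeral)
  have pos: "\<delta> * \<kappa> > 0" using \<open>\<kappa> > 0\<close> \<open>\<delta> > 0\<close> by simp
  have "\<bar>T\<bar>\<^sup>2 < 2\<^sup>2" using eq pos by simp
  then have "\<bar>T\<bar> < 2" by (rule power2_less_imp_less) simp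
  then have T2: "T = 0 \<or> T\<^sup>2 = 1" by (auto simp: abs_if power2_eq_1_iff split: if_splits)
  have "t\<^sup>2 mod 4 = 0 \<or> t\<^sup>2 mod 4 = 1"
  proof (cases "even t")
    case True then show ?thesis by (auto elim!: evenE simp: power2_eq_square)
  next
    case False
    then obtain j where "t = 2 * j + 1" by (auto elim: oddE)
    then have "t\<^sup>2 = 4 * (j\<^sup>2 + j) + 1" by (simp add: power2_eq_square algebra_simps)
    then show ?thesis by presburger
  qed
  then have "\<delta> mod 4 = 0 \<or> \<delta> mod 4 = 3" unfolding \<delta>_def by presburger
  moreover have "\<delta> \<le> \<delta> * \<kappa>" using \<open>\<kappa> > 0\<close> \<open>\<delta> > 0\<close> by simp
  then have "\<delta> \<le> 4" using eq zero_le_power2[of T] by linarith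
  ultimately have "\<delta> = 3 \<or> \<delta> = 4"
    using \<open>\<delta> > 0\<close> by presburger
  then show False
  proof
    assume "\<delta> = 3"
    \<comment> \<open>By \<open>K_iff\<close> the field depends on \<open>r\<close> only up to
      rational multiples, and \<open>\<omega>\<close> shows that \<open>r\<close> and
      \<open>sqrt 3\<close> are commensurable.\<close>
    then have h3: "2 * h = sqrt 3" using \<delta> h_pos by (intro real_sqrt_unique[symmetric]) (auto simp: power_mult_distrib)
    interpret K3: imaginary_quadratic "-3" "quadratic_field (-3)" by unfold_locales auto
    have r3: "K3.r = sqrt 3" by (simp add: K3.r_def)
    have "h / r \<in> \<rat>" using omega_in_O by (simp add: O_iff K_iff h_def)
    then have q: "sqrt 3 / r \<in> \<rat>" unfolding h3[symmetric] by (metis Rats_mult Rats_number_of times_divide_eq_right)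
    have "x / r \<in> \<rat> \<longleftrightarrow> x / sqrt 3 \<in> \<rat>" for x
    proof
      assume "x / r \<in> \<rat>"
      then have "(x / r) / (sqrt 3 / r) \<in> \<rat>" using q by (rule Rats_divide)
      then show "x / sqrt 3 \<in> \<rat>" using r_pos by simp
    next
      assume "x / sqrt 3 \<in> \<rat>"
      then have "(x / sqrt 3) * (sqrt 3 / r) \<in> \<rat>" using q by (rule Rats_mult)
      then show "x / r \<in> \<rat>" by simp
    qed
    then have "K = quadratic_field (-3)" using K_iff K3.K_iff r3 by auto
    then show False using K3 by simp
  next
    assume \<delta>4: "\<delta> = 4"
    then have "T = 0" using T2 eq \<open>\<delta> \<le> \<delta> * \<kappa>\<close> by auto
    have "h\<^sup>2 = 1" using \<delta>4 \<delta> by simp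
    then have h1: "h = 1" using h_pos by (simp add: power2_eq_1_iff)
    have gauss: "\<exists>i j. Re z = of_int i \<and> Im z = of_int j" if z: "z \<in> \<O>" for z
    proof -
      obtain p q :: int where pq: "2 * Re z = of_int p" "(cmod z)\<^sup>2 = of_int q"
        using z by (auto simp: O_iff elim!: Ints_cases)
      obtain j :: int where j: "Im z = of_int j" using Im_O[OF z] h1 by auto
      have "real_of_int (p\<^sup>2 + 4 * j\<^sup>2) = of_int (4 * q)"
        using pq j[symmetric] pq(1)[symmetric] pq(2)[symmetric] unfolding cmod_power2 by (simp add: power2_eq_square)
      then have "p\<^sup>2 + 4 * j\<^sup>2 = 4 * q" by linarith
      then have "p\<^sup>2 = 2 * (2 * q - 2 * j\<^sup>2)" by simp
      then have "even (p\<^sup>2)" by (metis dvd_triv_left)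
      then obtain i where "p = 2 * i" by (auto elim: evenE)
      then show ?thesis using pq(1) j by auto
    qed
    obtain a1 a2 where a: "Re a = of_int a1" "Im a = of_int a2" using gauss O by blast
    obtain b1 b2 where b: "Re b = of_int b1" "Im b = of_int b2" using gauss O by blast
    obtain c1 c2 where c: "Re c = of_int c1" "Im c = of_int c2" using gauss O by blast
    obtain e1 e2 where e: "Re e = of_int e1" "Im e = of_int e2" using gauss O by blast
    \<comment> \<open>In the sum the products of imaginary parts cancel and those of real parts
      double, giving an even integer equal to 1.\<close>
    have "Re (a * cnj e - b * cnj c) + Re (a * e - b * c) = 1"
      using T \<open>T = 0\<close> det by simp
    then have "real_of_int (2 * (a1 * e1 - b1 * c1)) = 1"
      by (simp add: a b c e algebra_simps)
    then have "2 * (a1 * e1 - b1 * c1) = 1" by linarith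
    then show False by presburger
  qed
qed

end

text \<open>Completing the square shows that \<open>4 * A\<close> times the form is never negative.
  If \<open>A = 0\<close>, the discriminant condition forces \<open>B = 0\<close> and only a
  multiple of one square remains.\<close>

lemma semidefinite_same_sign:
  assumes "B\<^sup>2 \<le> 4 * A * C"
    and pos: "A * x\<^sup>2 + B * x * y + C * y\<^sup>2 > (0::real)" and neg: "A * u\<^sup>2 + B * u * v + C * v\<^sup>2 < 0"
  shows False
proof (cases "A = 0")
  case True
  then have "B = 0" using assms(1) by (simp add: power2_eq_square) (meson mult_eq_0_iff not_le zero_less_mult_iff linorder_neqE_linordered_idom)
  then have "C * y\<^sup>2 > 0" "C * v\<^sup>2 < 0" using True pos neg by auto
  then show False by (auto simp: zero_less_mult_iff mult_less_0_iff)
next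
  case False
  have nonneg: "4 * A * (A * x\<^sup>2 + B * x * y + C * y\<^sup>2) \<ge> 0" for x y
  proof -
    have "4 * A * (A * x\<^sup>2 + B * x * y + C * y\<^sup>2) = (2 * A * x + B * y)\<^sup>2 + (4 * A * C - B\<^sup>2) * y\<^sup>2"
      by (simp add: power2_eq_square algebra_simps)
    then show ?thesis using assms(1) by simp
  qed
  show False using nonneg[of x y] nonneg[of u v] pos neg False
    by (auto simp: zero_le_mult_iff)
qed


section \<open>Oriented circles as Hermitian forms\<close>

definition herm :: "real \<Rightarrow> complex \<Rightarrow> real \<Rightarrow> complex \<Rightarrow> complex \<Rightarrow> real" where
  "herm A B D x y = A * (cmod x)\<^sup>2 + 2 * Re (B * x * cnj y) + D * (cmod y)\<^sup>2"

text \<open>The Hermitian form of determinant \<open>-1\<close> in homogeneous coordinates that is positive on the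
  interior and zero on the circle; its value at infinity is minus the curvature.\<close>
fun form :: "ocircle \<Rightarrow> complex \<Rightarrow> complex \<Rightarrow> real" where
  "form (Circle c \<rho> Counterclockwise) = herm (- (1 / \<rho>)) (cnj c / of_real \<rho>) ((\<rho>\<^sup>2 - (cmod c)\<^sup>2) / \<rho>)"
| "form (Circle c \<rho> Clockwise) = herm (1 / \<rho>) (- cnj c / of_real \<rho>) (- (\<rho>\<^sup>2 - (cmod c)\<^sup>2) / \<rho>)"
| "form (Line u t) = herm 0 (- \<i> * cnj u) (- 2 * t)"

text \<open>Passage from homogeneous coordinates to the sphere. The zero vector gets the default
  value \<open>None\<close>; since every form vanishes there, the lemmas comparing
  \<open>proj\<close> with a circle require a nonzero vector.\<close>

definition proj :: "complex \<Rightarrow> complex \<Rightarrow> complex option" where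
  "proj x y = (if y = 0 then None else Some (x / y))"

lemma herm_scale: "herm A B D (l * x) (l * y) = (cmod l)\<^sup>2 * herm A B D x y"
proof -
  have "Re (B * (l * x) * cnj (l * y)) = (cmod l)\<^sup>2 * Re (B * x * cnj y)"
    unfolding cmod_power2 by (simp add: power2_eq_square algebra_simps)
  then show ?thesis by (simp add: herm_def norm_mult power_mult_distrib algebra_simps)
qed

lemma herm_compose:
  "herm A B D (a * x + b * y) (c * x + e * y) =
   herm (herm A B D a c) (of_real A * a * cnj b + B * a * cnj e + cnj B * cnj b * c + of_real D * c * cnj e)
     (herm A B D b e) x y"
  unfolding herm_def cmod_power2 by (simp add: power2_eq_square algebra_simps)

text \<open>Multiplicativity of the determinant for the congruence of the matrix of the form by
  \<open>(a, b; c, e)\<close>; the long expression is the off-diagonal entry of the transformed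
  matrix.\<close>

lemma herm_compose_det:
  "(cmod (of_real A * a * cnj b + B * a * cnj e + cnj B * cnj b * c + of_real D * c * cnj e))\<^sup>2
     - herm A B D a c * herm A B D b e = (cmod (a * e - b * c))\<^sup>2 * ((cmod B)\<^sup>2 - A * D)"
proof -
  have h: "of_real (herm A B D x y) = of_real A * x * cnj x + B * x * cnj y + cnj B * cnj x * y + of_real D * y * cnj y" for x y
    unfolding herm_def cmod_power2 by (simp add: complex_eq_iff power2_eq_square algebra_simps)
  have "complex_of_real ((cmod (of_real A * a * cnj b + B * a * cnj e + cnj B * cnj b * c + of_real D * c * cnj e))\<^sup>2
     - herm A B D a c * herm A B D b e) = of_real ((cmod (a * e - b * c))\<^sup>2 * ((cmod B)\<^sup>2 - A * D))"
    unfolding of_real_diff of_real_mult h complex_norm_square by (simp add: algebra_simps)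
  then show ?thesis by (simp only: of_real_eq_iff)
qed

lemma herm_0_0: "herm A B D 0 0 = 0"
  by (simp add: herm_def)

lemma herm_eq_iff: "herm A B D = herm A' B' D' \<longleftrightarrow> A = A' \<and> B = B' \<and> D = D'"
proof
  assume "herm A B D = herm A' B' D'"
  then have *: "herm A B D x y = herm A' B' D' x y" for x y by simp
  have "A = A'" "D = D'" using *[of 1 0] *[of 0 1] by (simp_all add: herm_def)
  then show "A = A' \<and> B = B' \<and> D = D'"
    using *[of 1 1] *[of "\<i>" 1] by (simp add: herm_def complex_eq_iff)
qed simp

lemma form_eq_herm:
  assumes "wf_ocircle C"
  obtains A B D where "form C = herm A B D" "(cmod B)\<^sup>2 - A * D = 1" "curvature C = - A"
proof (cases C)
  case (Circle c \<rho> s)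
  then have "\<rho> > 0" using assms by simp
  then show ?thesis using that Circle
    by (cases s) (auto simp: norm_divide power_divide power2_eq_square field_simps)
next
  case (Line u t)
  then show ?thesis using that assms by (auto simp: norm_mult)
qed

lemma curvature_eq_form: "wf_ocircle C \<Longrightarrow> curvature C = - form C 1 0"
  by (erule form_eq_herm) (simp add: herm_def)

text \<open>Completing the square gives radius \<open>1 / \<bar>A\<bar>\<close>; the sign of
  \<open>A\<close> decides the orientation. For \<open>A = 0\<close> the determinant makes
  \<open>B\<close> a unit vector, and the circle is a line.\<close>

lemma ex_ocircle_form:
  assumes "(cmod B)\<^sup>2 - A * D = 1"
  shows "\<exists>C. wf_ocircle C \<and> form C = herm A B D"
proof -
  consider "A < 0" | "A > 0" | "A = 0" by linarith
  then show ?thesis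
  proof cases
    case 1
    define \<rho> where "\<rho> = - 1 / A"
    have \<rho>: "\<rho> > 0" "A = - (1 / \<rho>)" using 1 by (auto simp: \<rho>_def divide_simps)
    have "(cmod B)\<^sup>2 = 1 - D / \<rho>" using assms unfolding \<rho>(2) by simp
    moreover have "(\<rho>\<^sup>2 - (cmod (of_real \<rho> * cnj B))\<^sup>2) / \<rho> = \<rho> - \<rho> * (cmod B)\<^sup>2"
      using \<rho>(1) by (simp add: norm_mult power_mult_distrib field_simps power2_eq_square)
    ultimately have "(\<rho>\<^sup>2 - (cmod (of_real \<rho> * cnj B))\<^sup>2) / \<rho> = D"
      using \<rho>(1) by (simp add: right_diff_distrib)
    then show ?thesis using \<rho> by (intro exI[of _ "Circle (of_real \<rho> * cnj B) \<rho> Counterclockwise"]) simp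
  next
    case 2
    define \<rho> where "\<rho> = 1 / A"
    have \<rho>: "\<rho> > 0" "A = 1 / \<rho>" using 2 by (auto simp: \<rho>_def divide_simps)
    have "(cmod B)\<^sup>2 = 1 + D / \<rho>" using assms unfolding \<rho>(2) by simp
    then have "- (\<rho>\<^sup>2 - (cmod (- of_real \<rho> * cnj B))\<^sup>2) / \<rho> = D"
      using \<rho>(1) by (simp add: norm_mult power_mult_distrib field_simps power2_eq_square)
    then show ?thesis using \<rho> by (intro exI[of _ "Circle (- of_real \<rho> * cnj B) \<rho> Clockwise"]) simp
  next
    case 3
    then have "cmod B = 1" using assms by (simp add: power2_eq_1_iff) (smt (verit) norm_ge_zero)
    then show ?thesis using 3
      by (intro exI[of _ "Line (- \<i> * cnj B) (- D / 2)"]) (simp add: norm_mult)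
  qed
qed

lemma form_inj:
  assumes "wf_ocircle C" "wf_ocircle E" "form C = form E"
  shows "C = E"
proof -
  have pos: "- (1 / \<rho>) = 1 / \<rho>' \<Longrightarrow> \<not> (\<rho> > 0 \<and> \<rho>' > 0)" for \<rho> \<rho>' :: real
    by (metis less_asym neg_less_0_iff_less zero_less_divide_1_iff)
  show ?thesis
  proof (cases C rule: form.cases)
    case (1 c \<rho>)
    with assms show ?thesis
      by (cases E rule: form.cases) (use pos in \<open>auto simp: herm_eq_iff\<close>)
  next
    case (2 c \<rho>)
    with assms show ?thesis
      by (cases E rule: form.cases) (use pos[OF sym] in \<open>auto simp: herm_eq_iff\<close>)
  next
    case (3 u t)
    with assms show ?thesis
      by (cases E rule: form.cases) (auto simp: herm_eq_iff)
  qed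
qed

text \<open>For a circle, the value is the power of the point divided by the radius, with the sign
  set by the orientation.\<close>

lemma form_at_point:
  "\<rho> > 0 \<Longrightarrow> form (Circle c \<rho> Counterclockwise) z 1 = (\<rho>\<^sup>2 - (dist c z)\<^sup>2) / \<rho>"
  "\<rho> > 0 \<Longrightarrow> form (Circle c \<rho> Clockwise) z 1 = ((dist c z)\<^sup>2 - \<rho>\<^sup>2) / \<rho>"
  "0 < form (Line u t) z 1 \<longleftrightarrow> t < Im (cnj u * z)"
  "form (Line u t) z 1 = 0 \<longleftrightarrow> Im (cnj u * z) = t"
proof -
  have d: "(dist c z)\<^sup>2 = (cmod z)\<^sup>2 - 2 * Re (cnj c * z) + (cmod c)\<^sup>2"
    unfolding dist_norm cmod_power2 by (simp add: power2_eq_square algebra_simps)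
  show "\<rho> > 0 \<Longrightarrow> form (Circle c \<rho> Counterclockwise) z 1 = (\<rho>\<^sup>2 - (dist c z)\<^sup>2) / \<rho>"
    "\<rho> > 0 \<Longrightarrow> form (Circle c \<rho> Clockwise) z 1 = ((dist c z)\<^sup>2 - \<rho>\<^sup>2) / \<rho>"
    unfolding d by (simp_all add: herm_def field_simps)
  have "form (Line u t) z 1 = 2 * (Im (cnj u * z) - t)"
    by (simp add: herm_def algebra_simps)
  then show "0 < form (Line u t) z 1 \<longleftrightarrow> t < Im (cnj u * z)"
    "form (Line u t) z 1 = 0 \<longleftrightarrow> Im (cnj u * z) = t" by (smt (verit))+
qed

lemma form_normalize: "wf_ocircle C \<Longrightarrow> y \<noteq> 0 \<Longrightarrow> form C x y = (cmod y)\<^sup>2 * form C (x / y) 1"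
  by (metis form_eq_herm herm_scale mult.right_neutral nonzero_mult_div_cancel_left times_divide_eq_right)

lemma square_diff_quotient_sign:
  assumes "\<rho> > (0::real)"
  shows "0 < (\<rho>\<^sup>2 - (dist c z)\<^sup>2) / \<rho> \<longleftrightarrow> dist c z < \<rho>"
    "0 < ((dist c z)\<^sup>2 - \<rho>\<^sup>2) / \<rho> \<longleftrightarrow> \<not> dist c z \<le> \<rho>"
    "(\<rho>\<^sup>2 - (dist c z)\<^sup>2) / \<rho> = 0 \<longleftrightarrow> dist c z = \<rho>"
    "((dist c z)\<^sup>2 - \<rho>\<^sup>2) / \<rho> = 0 \<longleftrightarrow> dist c z = \<rho>"
proof -
  have 1: "(\<rho>\<^sup>2 - (dist c z)\<^sup>2) / \<rho> = (\<rho> - dist c z) * ((\<rho> + dist c z) / \<rho>)"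
    "((dist c z)\<^sup>2 - \<rho>\<^sup>2) / \<rho> = (dist c z - \<rho>) * ((\<rho> + dist c z) / \<rho>)"
    using assms by (simp_all add: field_simps power2_eq_square)
  have 2: "(\<rho> + dist c z) / \<rho> > 0"
    using assms zero_le_dist[of c z] by (intro divide_pos_pos add_pos_nonneg)
  show "0 < (\<rho>\<^sup>2 - (dist c z)\<^sup>2) / \<rho> \<longleftrightarrow> dist c z < \<rho>"
    "0 < ((dist c z)\<^sup>2 - \<rho>\<^sup>2) / \<rho> \<longleftrightarrow> \<not> dist c z \<le> \<rho>"
    unfolding 1 using 2 by (simp_all only: zero_less_mult_iff not_le) auto
  show "(\<rho>\<^sup>2 - (dist c z)\<^sup>2) / \<rho> = 0 \<longleftrightarrow> dist c z = \<rho>"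
    "((dist c z)\<^sup>2 - \<rho>\<^sup>2) / \<rho> = 0 \<longleftrightarrow> dist c z = \<rho>"
    unfolding 1 mult_eq_0_iff using 2 by auto
qed

lemma proj_in_interior:
  assumes "wf_ocircle C" "x \<noteq> 0 \<or> y \<noteq> 0"
  shows "proj x y \<in> oc_interior C \<longleftrightarrow> form C x y > 0"
proof (cases "y = 0")
  case True
  then show ?thesis using assms
    by (cases C rule: form.cases) (auto simp: proj_def herm_def zero_less_divide_iff divide_less_0_iff)
next
  case False
  have "proj x y \<in> oc_interior C \<longleftrightarrow> form C (x / y) 1 > 0"
    using assms(1) False
    by (cases C rule: form.cases)
      (simp_all add: proj_def form_at_point square_diff_quotient_sign image_iff del: form.simps times_divide_eq_right)
  then show ?thesis using form_normalize[OF assms(1) False, of x] False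
    by (simp add: zero_less_mult_iff)
qed

lemma proj_in_points:
  assumes "wf_ocircle C" "x \<noteq> 0 \<or> y \<noteq> 0"
  shows "proj x y \<in> points C \<longleftrightarrow> form C x y = 0"
proof (cases "y = 0")
  case True
  then show ?thesis using assms
    by (cases C rule: form.cases) (auto simp: proj_def herm_def)
next
  case False
  have "proj x y \<in> points C \<longleftrightarrow> form C (x / y) 1 = 0"
    using assms(1) False
    by (cases C rule: form.cases)
      (simp_all add: proj_def form_at_point square_diff_quotient_sign image_iff del: form.simps times_divide_eq_right divide_eq_0_iff)
  then show ?thesis using form_normalize[OF assms(1) False, of x] False
    by simp
qed

lemma proj_in_exterior:
  assumes "wf_ocircle C" "x \<noteq> 0 \<or> y \<noteq> 0"
  shows "proj x y \<in> oc_exterior C \<longleftrightarrow> form C x y < 0"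
  using proj_in_points[OF assms] proj_in_interior[OF assms] by (auto simp: oc_exterior_def)

lemma proj_cases:
  obtains x y where "p = proj x y" "x \<noteq> 0 \<or> y \<noteq> 0"
proof (cases p)
  case None
  then show ?thesis using that[of 1 0] by (simp add: proj_def)
next
  case (Some z)
  then show ?thesis using that[of z 1] by (simp add: proj_def)
qed

lemma proj_scale: "l \<noteq> 0 \<Longrightarrow> proj (l * x) (l * y) = proj x y"
  by (simp add: proj_def)

lemma proj_in_extended_reals:
  "proj x y \<in> extended_reals \<longleftrightarrow> Im (x * cnj y) = 0"
proof (cases "y = 0")
  case False
  have "x / y \<in> \<real> \<longleftrightarrow> Im (x / y) = 0" by (simp add: complex_is_Real_iff)
  also have "Im (x / y) = Im (x * cnj y) / (cmod y)\<^sup>2"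
    unfolding complex_div_cnj[of x y] by (simp only: Im_divide_of_real flip: of_real_power)
  also have "\<dots> = 0 \<longleftrightarrow> Im (x * cnj y) = 0" using False by simp
  finally show ?thesis using False by (auto simp: proj_def extended_reals_def)
qed (simp add: proj_def extended_reals_def)

lemma moebius_action_proj:
  assumes "x \<noteq> 0 \<or> y \<noteq> 0"
  shows "moebius_action M (proj x y) = proj (M$1$1 * x + M$1$2 * y) (M$2$1 * x + M$2$2 * y)"
proof (cases "y = 0")
  case False
  have "M$2$1 * (x / y) + M$2$2 = (M$2$1 * x + M$2$2 * y) / y"
    "M$1$1 * (x / y) + M$1$2 = (M$1$1 * x + M$1$2 * y) / y"
    using False by (simp_all add: field_simps)
  then show ?thesis using False by (simp add: proj_def moebius_def)
qed (use assms in \<open>simp add: proj_def\<close>)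

text \<open>A vector representing a point of the extended real line is a complex multiple of a real
  vector. This turns a Hermitian form restricted to a Bianchi circle into a real binary quadratic
  form.\<close>

lemma real_ray:
  assumes "Im (x * cnj y) = 0"
  obtains l s t where "x = l * of_real s" "y = l * of_real t"
proof (cases "y = 0")
  case True
  then show ?thesis using that[of x 1 0] by simp
next
  case False
  then have "x / y \<in> \<real>" using assms proj_in_extended_reals[of x y]
    by (auto simp: proj_def extended_reals_def)
  then obtain s where "x / y = of_real s" by (auto elim: Reals_cases)
  then show ?thesis using that[of y s 1] False by (simp add: field_simps)
qed

section \<open>Charts of Bianchi circles, integrality of their forms, and non-crossing\<close>

context imaginary_quadratic
begin

text \<open>The Moebius transformation \<open>(a, b; c, e)\<close> maps the real line to \<open>C\<close>, and the upper half-plane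
  to the interior of \<open>C\<close> if \<open>\<sigma> = 1\<close>, to the exterior if \<open>\<sigma> = -1\<close>.\<close>
definition chart :: "ocircle \<Rightarrow> complex \<Rightarrow> complex \<Rightarrow> complex \<Rightarrow> complex \<Rightarrow> real \<Rightarrow> bool" where
  "chart C a b c e \<sigma> \<longleftrightarrow> a \<in> \<O> \<and> b \<in> \<O> \<and> c \<in> \<O> \<and> e \<in> \<O> \<and> a * e - b * c = 1 \<and> (\<sigma> = 1 \<or> \<sigma> = -1) \<and>
    (\<forall>x y. form C (a * x + b * y) (c * x + e * y) = \<sigma> * (2 * Im (x * cnj y)))"

lemma SL2_inverse_image:
  assumes "a * e - b * c = (1::complex)"
  shows "a * (e * x - b * y) + b * (a * y - c * x) = x" "c * (e * x - b * y) + e * (a * y - c * x) = y"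
proof -
  have "a * (e * x - b * y) + b * (a * y - c * x) = (a * e - b * c) * x"
    "c * (e * x - b * y) + e * (a * y - c * x) = (a * e - b * c) * y"
    by (simp_all add: algebra_simps)
  then show "a * (e * x - b * y) + b * (a * y - c * x) = x" "c * (e * x - b * y) + e * (a * y - c * x) = y"
    using assms by simp_all
qed

lemma SL2_nonzero:
  assumes "a * e - b * c = (1::complex)" "x \<noteq> 0 \<or> y \<noteq> 0"
  shows "a * x + b * y \<noteq> 0 \<or> c * x + e * y \<noteq> 0"
proof -
  have "(a * e - b * c) * x = e * (a * x + b * y) - b * (c * x + e * y)"
    "(a * e - b * c) * y = a * (c * x + e * y) - c * (a * x + b * y)"
    by (simp_all add: algebra_simps)
  then show ?thesis using assms by auto
qed

lemma chart_coordinates: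
  assumes "a * e - b * c = (1::complex)"
  obtains x' y' where "x = a * x' + b * y'" "y = c * x' + e * y'"
  using SL2_inverse_image[OF assms] by metis

lemma chart_inverse:
  assumes "chart C a b c e \<sigma>"
  shows "form C x y = \<sigma> * (2 * Im ((e * x - b * y) * cnj (a * y - c * x)))"
proof -
  have "a * e - b * c = 1" using assms by (simp add: chart_def)
  from SL2_inverse_image[OF this, of x y] show ?thesis
    using assms unfolding chart_def by metis
qed

text \<open>The form of \<open>C\<close>, pulled back along the matrix, vanishes on the extended
  reals. Testing at infinity, 0 and 1 kills everything but the imaginary part of the off-diagonal
  entry, and determinant -1 makes that part 1 or -1: this is the sign \<open>\<sigma>\<close>, up to
  negation.\<close>

lemma oriented_bianchi_circle_iff_chart:
  "C \<in> oriented_bianchi_circles K \<longleftrightarrow> wf_ocircle C \<and> (\<exists>a b c e \<sigma>. chart C a b c e \<sigma>)"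
proof (intro iffI conjI)
  assume C: "C \<in> oriented_bianchi_circles K"
  then show wf: "wf_ocircle C" by (simp add: oriented_bianchi_circles_def)
  obtain M where M: "points C = moebius_action M ` extended_reals" "M \<in> SL2_integers K"
    using C by (auto simp: oriented_bianchi_circles_def bianchi_circles_def)
  define a b c e where "a = M$1$1" and "b = M$1$2" and "c = M$2$1" and "e = M$2$2"
  have O: "a \<in> \<O>" "b \<in> \<O>" "c \<in> \<O>" "e \<in> \<O>" and det: "a * e - b * c = 1"
    using M(2) by (auto simp: SL2_integers_def a_def b_def c_def e_def det_2)
  obtain A B D where f: "form C = herm A B D" "(cmod B)\<^sup>2 - A * D = 1"
    using form_eq_herm[OF wf] by metis
  define A' B' D' where "A' = herm A B D a c" and "B' = of_real A * a * cnj b + B * a * cnj e + cnj B * cnj b * c + of_real D * c * cnj e"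
    and "D' = herm A B D b e"
  have F: "form C (a * x + b * y) (c * x + e * y) = herm A' B' D' x y" for x y
    unfolding f A'_def B'_def D'_def by (rule herm_compose)
  have disc: "(cmod B')\<^sup>2 - A' * D' = 1"
    using herm_compose_det[of A a b B e c D] det f by (simp add: A'_def B'_def D'_def)
  have nz: "a * x + b * y \<noteq> 0 \<or> c * x + e * y \<noteq> 0" if "x \<noteq> 0 \<or> y \<noteq> 0" for x y
    using SL2_nonzero[OF det that] .
  have zero: "herm A' B' D' x y = 0" if "Im (x * cnj y) = 0" "x \<noteq> 0 \<or> y \<noteq> 0" for x y
  proof -
    have "moebius_action M (proj x y) \<in> points C"
      using that(1) M(1) proj_in_extended_reals by blast
    then have "proj (a * x + b * y) (c * x + e * y) \<in> points C"
      using moebius_action_proj[OF that(2)] by (simp add: a_def b_def c_def e_def)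
    then show ?thesis using proj_in_points[OF wf nz[OF that(2)]] F by simp
  qed
  have "A' = 0" "D' = 0" "Re B' = 0"
    using zero[of 1 0] zero[of 0 1] zero[of 1 1] by (auto simp: herm_def)
  moreover from this have "(Im B')\<^sup>2 = 1" using disc by (simp add: cmod_power2)
  then have "Im B' = 1 \<or> Im B' = -1" by (simp add: power2_eq_1_iff)
  ultimately have "chart C a b c e (- Im B')"
    using O det F by (auto simp: chart_def herm_def)
  then show "\<exists>a b c e \<sigma>. chart C a b c e \<sigma>" by blast
next
  assume "wf_ocircle C \<and> (\<exists>a b c e \<sigma>. chart C a b c e \<sigma>)"
  then obtain a b c e \<sigma> where wf: "wf_ocircle C" and ch: "chart C a b c e \<sigma>" by blast
  define M :: "complex^2^2" where "M = (\<chi> i j. if i = 1 then (if j = 1 then a else b) else (if j = 1 then c else e))"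
  have M: "M$1$1 = a" "M$1$2 = b" "M$2$1 = c" "M$2$2 = e" by (simp_all add: M_def)
  have det: "a * e - b * c = 1" and \<sigma>: "\<sigma> \<noteq> 0" using ch by (auto simp: chart_def)
  have "M \<in> SL2_integers K"
    using ch M by (auto simp: SL2_integers_def det_2 chart_def forall_2)
  moreover have "points C = moebius_action M ` extended_reals"
  proof (intro equalityI subsetI)
    fix p assume p: "p \<in> points C"
    obtain x y where xy: "p = proj x y" "x \<noteq> 0 \<or> y \<noteq> 0" by (rule proj_cases)
    obtain u v where uv: "x = a * u + b * v" "y = c * u + e * v" by (rule chart_coordinates[OF det])
    have "form C x y = 0" using p xy proj_in_points[OF wf] by simp
    then have "Im (u * cnj v) = 0" using ch \<sigma> unfolding uv chart_def by simp
    then have "proj u v \<in> extended_reals" by (simp only: proj_in_extended_reals)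
    moreover have "u \<noteq> 0 \<or> v \<noteq> 0" using xy(2) uv by auto
    then have "moebius_action M (proj u v) = p" using moebius_action_proj M xy uv by simp
    ultimately show "p \<in> moebius_action M ` extended_reals" by blast
  next
    fix p assume "p \<in> moebius_action M ` extended_reals"
    then obtain q where q: "q \<in> extended_reals" "p = moebius_action M q" by blast
    obtain u v where uv: "q = proj u v" "u \<noteq> 0 \<or> v \<noteq> 0" by (rule proj_cases)
    have Im: "Im (u * cnj v) = 0" using q uv proj_in_extended_reals by simp
    have p: "p = proj (a * u + b * v) (c * u + e * v)" using q uv moebius_action_proj M by simp
    have nz: "a * u + b * v \<noteq> 0 \<or> c * u + e * v \<noteq> 0"
      using SL2_nonzero[OF det uv(2)] .
    have "form C (a * u + b * v) (c * u + e * v) = 0" using ch Im by (simp add: chart_def)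
    then show "p \<in> points C" using p proj_in_points[OF wf nz] by simp
  qed
  ultimately show "C \<in> oriented_bianchi_circles K"
    using wf by (auto simp: oriented_bianchi_circles_def bianchi_circles_def)
qed

text \<open>In chart coordinates an integral vector stays integral, and imaginary parts of integers
  of the field are multiples of \<open>h\<close>. The vector \<open>(1, 0)\<close> yields the
  integrality of reduced curvatures.\<close>

lemma form_O:
  assumes "chart C a b c e \<sigma>" "x \<in> \<O>" "y \<in> \<O>"
  shows "\<exists>k::int. form C x y = 2 * h * of_int k"
proof -
  have "(e * x - b * y) * cnj (a * y - c * x) \<in> \<O>"
    using assms O_intros by (simp add: chart_def)
  then obtain k :: int where "Im ((e * x - b * y) * cnj (a * y - c * x)) = of_int k * h"
    using Im_O by blast
  then have 1: "form C x y = \<sigma> * (2 * (of_int k * h))" using chart_inverse[OF assms(1)] by simp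
  consider "\<sigma> = 1" | "\<sigma> = -1" using assms by (auto simp: chart_def)
  then show ?thesis
    by cases (use 1 in \<open>force intro: exI[of _ k] exI[of _ "-k"]\<close>)+
qed

lemma reduced_curvature_eq:
  assumes "C \<in> oriented_bianchi_circles K"
  shows "curvature C = of_int (reduced_curvature (discriminant K) C) * (2 * h)"
proof -
  obtain a b c e \<sigma> where ch: "chart C a b c e \<sigma>" and wf: "wf_ocircle C"
    using assms oriented_bianchi_circle_iff_chart by blast
  obtain k :: int where "form C 1 0 = 2 * h * of_int k" using form_O[OF ch] O_1 O_0 by blast
  then have "curvature C = of_int (- k) * (2 * h)" using curvature_eq_form[OF wf] by simp
  then obtain n where k: "curvature C = of_int n * (2 * h)" by blast
  then have "reduced_curvature (discriminant K) C = n"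
    unfolding reduced_curvature_def sqrt_discriminant using h_pos by (intro the_equality) auto
  then show ?thesis using k by simp
qed

text \<open>Restricted to the points of \<open>C\<close>, the form of \<open>E\<close> is a real
  binary form coming from an integral matrix of determinant 1. By
  \<open>binary_form_semidefinite\<close> it cannot take both signs.\<close>

lemma no_crossing:
  assumes K3: "K \<noteq> quadratic_field (- 3)"
    and C: "C \<in> oriented_bianchi_circles K" and E: "E \<in> oriented_bianchi_circles K"
    and pos: "form C x y = 0" "form E x y > 0" and neg: "form C u v = 0" "form E u v < 0"
  shows False
proof -
  obtain a b c e \<sigma> where ch: "chart C a b c e \<sigma>"
    using C oriented_bianchi_circle_iff_chart by blast
  obtain a' b' c' e' \<tau> where ch': "chart E a' b' c' e' \<tau>" and wf: "wf_ocircle E"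
    using E oriented_bianchi_circle_iff_chart by blast
  have det: "a * e - b * c = 1" and \<sigma>: "\<sigma> \<noteq> 0" and det': "a' * e' - b' * c' = 1"
    using ch ch' by (auto simp: chart_def)
  \<comment> \<open>The entries of the inverse of the chart of \<open>E\<close> times the chart of
    \<open>C\<close>.\<close>
  define p q r s where "p = e' * a - b' * c" and "q = e' * b - b' * e"
    and "r = a' * c - c' * a" and "s = a' * e - c' * b"
  have O: "p \<in> \<O>" "q \<in> \<O>" "r \<in> \<O>" "s \<in> \<O>"
    using ch ch' O_intros by (auto simp: p_def q_def r_def s_def chart_def)
  have "p * s - q * r = (a * e - b * c) * (a' * e' - b' * c')"
    by (simp add: p_def q_def r_def s_def algebra_simps)
  then have ps: "p * s - q * r = 1" using det det' by simp
  define Q where "Q m n = Im (p * cnj r) * m\<^sup>2 + Im (p * cnj s + q * cnj r) * m * n + Im (q * cnj s) * n\<^sup>2" for m n :: real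
  have *: "\<exists>l m n. form E x y = l * \<tau> * Q m n \<and> l \<ge> 0" if "form C x y = 0" for x y
  proof -
    obtain x' y' where xy: "x = a * x' + b * y'" "y = c * x' + e * y'" by (rule chart_coordinates[OF det])
    then have "Im (x' * cnj y') = 0" using that ch \<sigma> by (simp add: chart_def)
    then obtain l m n where lmn: "x' = l * of_real m" "y' = l * of_real n" by (rule real_ray)
    obtain A B D where f: "form E = herm A B D" using form_eq_herm[OF wf] by metis
    have "form E x y = form E (l * (a * m + b * n)) (l * (c * m + e * n))"
      by (simp add: xy lmn algebra_simps)
    also have "\<dots> = (cmod l)\<^sup>2 * form E (a * m + b * n) (c * m + e * n)"
      unfolding f by (rule herm_scale)
    also have "form E (a * m + b * n) (c * m + e * n) = \<tau> * (2 * Im ((p * m + q * n) * cnj (r * m + s * n)))"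
      unfolding chart_inverse[OF ch'] by (simp add: p_def q_def r_def s_def algebra_simps)
    also have "Im ((p * m + q * n) * cnj (r * m + s * n)) = Q m n"
      by (simp add: Q_def power2_eq_square algebra_simps)
    finally have "form E x y = (2 * (cmod l)\<^sup>2) * \<tau> * Q m n" by simp
    then show ?thesis by (metis zero_le_power2 mult_nonneg_nonneg zero_le_numeral)
  qed
  obtain l m n where 1: "form E x y = l * \<tau> * Q m n" "l \<ge> 0" using *[OF pos(1)] by blast
  obtain l' m' n' where 2: "form E u v = l' * \<tau> * Q m' n'" "l' \<ge> 0" using *[OF neg(1)] by blast
  note sd = semidefinite_same_sign[OF binary_form_semidefinite[OF K3 O ps]]
  have "\<tau> = 1 \<or> \<tau> = -1" using ch' by (simp add: chart_def)
  then show False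
  proof
    assume "\<tau> = 1"
    then have "Q m n > 0" "Q m' n' < 0" using 1 2 pos(2) neg(2) by (auto simp: zero_less_mult_iff mult_less_0_iff)
    then show False unfolding Q_def by (rule sd)
  next
    assume "\<tau> = -1"
    then have "Q m' n' > 0" "Q m n < 0" using 1 2 pos(2) neg(2) by (auto simp: zero_less_mult_iff mult_less_0_iff)
    then show False unfolding Q_def by (rule sd)
  qed
qed

end


section \<open>Neighbours in a packing\<close>

lemma form_0_0: "wf_ocircle C \<Longrightarrow> form C 0 0 = 0"
  by (metis form_eq_herm herm_0_0)

lemma interiors_disjoint_iff:
  assumes "wf_ocircle C" "wf_ocircle D"
  shows "oc_interior C \<inter> oc_interior D = {} \<longleftrightarrow> (\<forall>x y. form C x y > 0 \<longrightarrow> form D x y \<le> 0)"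
proof (intro iffI allI impI)
  fix x y assume "oc_interior C \<inter> oc_interior D = {}" "form C x y > 0"
  moreover from this have "x \<noteq> 0 \<or> y \<noteq> 0" using form_0_0[OF assms(1)] by auto
  ultimately show "form D x y \<le> 0"
    using proj_in_interior[of _ x y] assms by (metis disjoint_iff not_le)
next
  assume *: "\<forall>x y. form C x y > 0 \<longrightarrow> form D x y \<le> 0"
  show "oc_interior C \<inter> oc_interior D = {}"
  proof (rule ccontr)
    assume "\<not> ?thesis"
    then obtain p where p: "p \<in> oc_interior C" "p \<in> oc_interior D" by blast
    obtain x y where "p = proj x y" "x \<noteq> 0 \<or> y \<noteq> 0" by (rule proj_cases)
    then show False using p * proj_in_interior assms by (metis not_le)
  qed
qed

lemma points_meet_iff:
  assumes "\<forall>D\<in>P. wf_ocircle D" "wf_ocircle C"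
  shows "(\<Union>D\<in>P. points D) \<inter> oc_interior C \<noteq> {} \<longleftrightarrow> (\<exists>D\<in>P. \<exists>x y. form D x y = 0 \<and> form C x y > 0)"
    and "(\<Union>D\<in>P. points D) \<inter> oc_exterior C \<noteq> {} \<longleftrightarrow> (\<exists>D\<in>P. \<exists>x y. form D x y = 0 \<and> form C x y < 0)"
proof -
  have *: "(\<Union>D\<in>P. points D) \<inter> S \<noteq> {} \<longleftrightarrow> (\<exists>D\<in>P. \<exists>x y. form D x y = 0 \<and> T x y)"
    if S: "\<And>x y. x \<noteq> 0 \<or> y \<noteq> 0 \<Longrightarrow> proj x y \<in> S \<longleftrightarrow> T x y" and T: "\<not> T 0 0" for S T
  proof
    assume "(\<Union>D\<in>P. points D) \<inter> S \<noteq> {}"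
    then obtain D p where D: "D \<in> P" "p \<in> points D" "p \<in> S" by blast
    obtain x y where "p = proj x y" "x \<noteq> 0 \<or> y \<noteq> 0" by (rule proj_cases)
    then show "\<exists>D\<in>P. \<exists>x y. form D x y = 0 \<and> T x y"
      using D S proj_in_points assms(1) by metis
  next
    assume "\<exists>D\<in>P. \<exists>x y. form D x y = 0 \<and> T x y"
    then obtain D x y where D: "D \<in> P" "form D x y = 0" "T x y" by blast
    then have nz: "x \<noteq> 0 \<or> y \<noteq> 0" using T by auto
    then have "proj x y \<in> points D" "proj x y \<in> S"
      using D S[OF nz] proj_in_points[OF _ nz] assms(1) by auto
    then show "(\<Union>D\<in>P. points D) \<inter> S \<noteq> {}" using D(1) by blast
  qed
  show "(\<Union>D\<in>P. points D) \<inter> oc_interior C \<noteq> {} \<longleftrightarrow> (\<exists>D\<in>P. \<exists>x y. form D x y = 0 \<and> form C x y > 0)"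
    using proj_in_interior[OF assms(2)] form_0_0[OF assms(2)] by (intro *) auto
  show "(\<Union>D\<in>P. points D) \<inter> oc_exterior C \<noteq> {} \<longleftrightarrow> (\<exists>D\<in>P. \<exists>x y. form D x y = 0 \<and> form C x y < 0)"
    using proj_in_exterior[OF assms(2)] form_0_0[OF assms(2)] by (intro *) auto
qed

lemma straddles_iff:
  assumes "\<forall>D\<in>P. wf_ocircle D" "wf_ocircle C"
  shows "straddles P C \<longleftrightarrow> (\<exists>D\<in>P. \<exists>x y. form D x y = 0 \<and> form C x y > 0) \<and>
    (\<exists>D\<in>P. \<exists>x y. form D x y = 0 \<and> form C x y < 0)"
  unfolding straddles_def points_meet_iff[OF assms] ..

lemma points_eq_if_opposite:
  assumes "wf_ocircle C" "wf_ocircle X" "\<And>x y. form X x y = - form C x y"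
  shows "points X = points C"
proof (intro set_eqI)
  fix p
  obtain x y where "p = proj x y" "x \<noteq> 0 \<or> y \<noteq> 0" by (rule proj_cases)
  then show "p \<in> points X \<longleftrightarrow> p \<in> points C" using assms by (simp add: proj_in_points)
qed

lemma herm_uminus: "herm (- A) (- B) (- D) x y = - herm A B D x y"
  by (simp add: herm_def)

section \<open>Signs of Hermitian forms on half-planes and their boundaries\<close>

lemma quadratic_nonpos_limit:
  assumes "\<eta> > 0" "\<And>\<epsilon>. 0 < \<epsilon> \<Longrightarrow> \<epsilon> < \<eta> \<Longrightarrow> p + q * \<epsilon> + r * \<epsilon>\<^sup>2 \<le> (0::real)"
  shows "p \<le> 0"
proof -
  have "((\<lambda>\<epsilon>. p + q * \<epsilon> + r * \<epsilon>\<^sup>2) \<longlongrightarrow> p + q * 0 + r * 0\<^sup>2) (at_right 0)"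
    by (intro tendsto_intros)
  moreover have "eventually (\<lambda>\<epsilon>. p + q * \<epsilon> + r * \<epsilon>\<^sup>2 \<le> 0) (at_right 0)"
    using assms by (auto simp: eventually_at_right_field)
  ultimately have "p + q * 0 + r * 0\<^sup>2 \<le> 0" by (intro tendsto_upperbound) auto
  then show ?thesis by simp
qed

text \<open>Along a line of homogeneous vectors the form is a quadratic polynomial in
  \<open>\<epsilon>\<close>, so a weak sign condition passes to the limit. Homogeneous coordinates
  allow the limit point to be infinity.\<close>

lemma herm_nonpos_limit:
  assumes "\<eta> > 0"
    "\<And>\<epsilon>. 0 < \<epsilon> \<Longrightarrow> \<epsilon> < \<eta> \<Longrightarrow> herm A B D (x + of_real \<epsilon> * u) (y + of_real \<epsilon> * v) \<le> 0"
  shows "herm A B D x y \<le> 0"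
proof -
  define q where "q = 2 * A * Re (x * cnj u) + 2 * Re (B * (x * cnj v + u * cnj y)) + 2 * D * Re (y * cnj v)"
  have "herm A B D (x + of_real \<epsilon> * u) (y + of_real \<epsilon> * v) = herm A B D x y + q * \<epsilon> + herm A B D u v * \<epsilon>\<^sup>2" for \<epsilon>
    unfolding herm_def cmod_power2 q_def by (simp add: power2_eq_square algebra_simps)
  then show ?thesis using quadratic_nonpos_limit[OF assms(1)] assms(2) by metis
qed

lemma herm_nonneg_limit:
  assumes "\<eta> > 0"
    "\<And>\<epsilon>. 0 < \<epsilon> \<Longrightarrow> \<epsilon> < \<eta> \<Longrightarrow> herm A B D (x + of_real \<epsilon> * u) (y + of_real \<epsilon> * v) \<ge> 0"
  shows "herm A B D x y \<ge> 0"
  using herm_nonpos_limit[OF assms(1), of "-A" "-B" "-D" x u y v] assms(2) by (simp add: herm_uminus)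

text \<open>Three points on the imaginary axis determine \<open>A\<close>, \<open>Im B\<close> and
  \<open>D\<close>; one point off the axis gives \<open>Re B\<close>. The conclusion is incompatible
  with determinant -1.\<close>

lemma herm_not_vanishing_on_halfplane:
  assumes "\<sigma> = 1 \<or> \<sigma> = (-1::real)" "\<And>x. \<sigma> * Im x > 0 \<Longrightarrow> herm A B D x 1 = 0"
  shows "A = 0 \<and> B = 0 \<and> D = 0"
proof -
  have "herm A B D (of_real (\<sigma> * s) * \<i>) 1 = 0" if "s > 0" for s
    using assms(1) that by (intro assms(2)) auto
  from this[of 1] this[of 2] this[of 3] have 1: "A = 0" "Im B = 0" "D = 0"
    using assms(1) by (auto simp: herm_def cmod_power2 norm_mult)
  have "herm A B D (1 + of_real \<sigma> * \<i>) 1 = 0"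
    using assms(1) by (intro assms(2)) auto
  then show ?thesis using 1 by (simp add: herm_def complex_eq_iff)
qed

text \<open>A half-plane is connected, so a continuous function without zeros on it keeps its
  sign.\<close>

lemma herm_halfplane_sign:
  assumes "\<And>x. \<sigma> * Im x > h \<Longrightarrow> herm A B D x 1 \<noteq> 0"
    and "\<sigma> * Im x\<^sub>0 > h" "herm A B D x\<^sub>0 1 > 0" "\<sigma> * Im x > h"
  shows "herm A B D x 1 > 0"
proof (rule ccontr)
  assume contra: "\<not> ?thesis"
  define H where "H = {x. \<sigma> * Im x > h}"
  have "H = {x. inner (of_real \<sigma> * \<i>) x > h}" by (auto simp: H_def inner_complex_def)
  then have "connected H" by (simp add: convex_connected convex_halfspace_gt)
  moreover have "continuous_on H (\<lambda>x. herm A B D x 1)"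
    unfolding herm_def by (intro continuous_intros)
  ultimately have "connected ((\<lambda>x. herm A B D x 1) ` H)" by (rule connected_continuous_image[rotated])
  moreover have "herm A B D x 1 \<in> (\<lambda>x. herm A B D x 1) ` H" "herm A B D x\<^sub>0 1 \<in> (\<lambda>x. herm A B D x 1) ` H"
    using assms by (auto simp: H_def)
  ultimately have "0 \<in> (\<lambda>x. herm A B D x 1) ` H"
    using contra assms(3) by (meson connectedD_interval less_imp_le not_le)
  then show False using assms(1) by (auto simp: H_def)
qed

section \<open>Changes of chart, tangent neighbours, and their membership in the packing\<close>

context imaginary_quadratic
begin

text \<open>Precomposition with the map from \<open>z\<close> to \<open>-1/z\<close>, which
  preserves the upper half-plane and hence \<open>\<sigma>\<close>. The image of infinity moves to
  that of 0, and the lower left entry becomes \<open>e\<close>.\<close>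

lemma chart_S: "chart C a b c e \<sigma> \<Longrightarrow> chart C b (- a) e (- c) \<sigma>"
proof -
  assume ch: "chart C a b c e \<sigma>"
  then have H: "form C (a * (- y) + b * x) (c * (- y) + e * x) = \<sigma> * (2 * Im ((- y) * cnj x))" for x y
    unfolding chart_def by blast
  have "form C (b * x + (- a) * y) (e * x + (- c) * y) = \<sigma> * (2 * Im (x * cnj y))" for x y
    using H[of y x] by (simp add: algebra_simps)
  then show ?thesis using ch O_uminus by (auto simp: chart_def algebra_simps)
qed

text \<open>Precomposition with the map from \<open>z\<close> to \<open>z/(z+1)\<close>. The image
  of infinity moves to that of 1, and the lower left entry becomes \<open>c + e\<close>.\<close>

lemma chart_T: "chart C a b c e \<sigma> \<Longrightarrow> chart C (a + b) b (c + e) e \<sigma>"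
proof -
  assume ch: "chart C a b c e \<sigma>"
  then have H: "form C (a * x + b * (x + y)) (c * x + e * (x + y)) = \<sigma> * (2 * Im (x * cnj (x + y)))" for x y
    unfolding chart_def by blast
  have "form C ((a + b) * x + b * y) ((c + e) * x + e * y) = \<sigma> * (2 * Im (x * cnj y))" for x y
    using H[of x y] by (simp add: algebra_simps)
  then show ?thesis using ch O_add by (auto simp: chart_def algebra_simps)
qed

lemma bianchi_wf: "C \<in> oriented_bianchi_circles K \<Longrightarrow> wf_ocircle C"
  by (simp add: oriented_bianchi_circles_def)

text \<open>The last coefficient is the value of the form at the integral vector
  \<open>(b, e)\<close>, hence a multiple of \<open>2 * h\<close>. Once \<open>A = 0\<close>, this
  is the quantisation of heights.\<close>

lemma pullback_herm:
  assumes "E \<in> oriented_bianchi_circles K" "a \<in> \<O>" "b \<in> \<O>" "c \<in> \<O>" "e \<in> \<O>" "a * e - b * c = 1"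
  obtains A B D and k :: int where "\<And>x y. form E (a * x + b * y) (c * x + e * y) = herm A B D x y"
    "(cmod B)\<^sup>2 - A * D = 1" "D = 2 * h * of_int k"
proof -
  obtain A B D where f: "form E = herm A B D" "(cmod B)\<^sup>2 - A * D = 1"
    using form_eq_herm[OF bianchi_wf[OF assms(1)]] by metis
  obtain k :: int where k: "form E b e = 2 * h * of_int k"
    using form_O assms oriented_bianchi_circle_iff_chart by metis
  show ?thesis
  proof (rule that)
    show "form E (a * x + b * y) (c * x + e * y) =
      herm (herm A B D a c) (of_real A * a * cnj b + B * a * cnj e + cnj B * cnj b * c + of_real D * c * cnj e) (herm A B D b e) x y" for x y
      unfolding f by (rule herm_compose)
    show "(cmod (of_real A * a * cnj b + B * a * cnj e + cnj B * cnj b * c + of_real D * c * cnj e))\<^sup>2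
        - herm A B D a c * herm A B D b e = 1"
      unfolding herm_compose_det assms(6) using f by simp
    show "herm A B D b e = 2 * h * of_int k" using k f by simp
  qed
qed

text \<open>In the coordinates of the chart, \<open>C\<close> is the real line and \<open>C'\<close> is the parallel line at
  distance \<open>h\<close>, on the exterior side of \<open>C\<close> and with interior pointing away from \<open>C\<close>.\<close>
lemma ex_neighbour:
  assumes ch: "chart C a b c e \<sigma>"
  obtains C' where "C' \<in> oriented_bianchi_circles K"
    "\<And>x y. form C' (a * x + b * y) (c * x + e * y) = - \<sigma> * (2 * Im (x * cnj y)) - 2 * h * (cmod y)\<^sup>2"
proof -
  have O: "a \<in> \<O>" "b \<in> \<O>" "c \<in> \<O>" "e \<in> \<O>" and det: "a * e - b * c = 1" and \<sigma>: "\<sigma> = 1 \<or> \<sigma> = -1"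
    using ch by (auto simp: chart_def)
  \<comment> \<open>The desired form in chart coordinates; pulling it back along the inverse matrix
    \<open>(e, -b; -c, a)\<close> produces \<open>C'\<close>.\<close>
  define A B D where "A = (0::real)" and "B = of_real \<sigma> * \<i>" and "D = - 2 * h"
  have disc: "(cmod B)\<^sup>2 - A * D = 1" using \<sigma> by (auto simp: A_def B_def norm_mult)
  have "(cmod (of_real A * e * cnj (- b) + B * e * cnj a + cnj B * cnj (- b) * (- c) + of_real D * (- c) * cnj a))\<^sup>2
     - herm A B D e (- c) * herm A B D (- b) a = 1"
    using herm_compose_det[of A e "-b" B a "-c" D] disc det by (simp add: mult.commute)
  from ex_ocircle_form[OF this] obtain C' where C': "wf_ocircle C'"
    "form C' = herm (herm A B D e (- c)) (of_real A * e * cnj (- b) + B * e * cnj a + cnj B * cnj (- b) * (- c) + of_real D * (- c) * cnj a) (herm A B D (- b) a)"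
    by blast
  have F: "form C' (a * x + b * y) (c * x + e * y) = - \<sigma> * (2 * Im (x * cnj y)) - 2 * h * (cmod y)\<^sup>2" for x y
  proof -
    have "form C' (a * x + b * y) (c * x + e * y) =
      herm A B D (e * (a * x + b * y) + (- b) * (c * x + e * y)) ((- c) * (a * x + b * y) + a * (c * x + e * y))"
      unfolding C' by (rule herm_compose[symmetric])
    also have "e * (a * x + b * y) + (- b) * (c * x + e * y) = (a * e - b * c) * x"
      by (simp add: algebra_simps)
    also have "(- c) * (a * x + b * y) + a * (c * x + e * y) = (a * e - b * c) * y"
      by (simp add: algebra_simps)
    also have "herm A B D ((a * e - b * c) * x) ((a * e - b * c) * y) = - \<sigma> * (2 * Im (x * cnj y)) - 2 * h * (cmod y)\<^sup>2"
      unfolding det by (simp add: herm_def A_def B_def D_def algebra_simps)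
    finally show ?thesis .
  qed
  \<comment> \<open>Translation by \<open>w\<close> carries the real line to the line at height
    \<open>- \<sigma> * h\<close>. That \<open>w\<close> is integral makes \<open>C'\<close> a
    Bianchi circle, with the sign of its chart reversed.\<close>
  define w where "w = - of_int (if \<sigma> = 1 then 1 else -1) * \<omega>"
  have w: "w \<in> \<O>" "Im w = - \<sigma> * h" using \<sigma> omega_in_O O_intros by (auto simp: w_def h_def)
  have "form C' (a * x + (a * w + b) * y) (c * x + (c * w + e) * y) = - \<sigma> * (2 * Im (x * cnj y))" for x y
  proof -
    have "form C' (a * x + (a * w + b) * y) (c * x + (c * w + e) * y) = form C' (a * (x + w * y) + b * y) (c * (x + w * y) + e * y)"
      by (simp add: algebra_simps)
    also have "\<dots> = - \<sigma> * (2 * Im ((x + w * y) * cnj y)) - 2 * h * (cmod y)\<^sup>2" by (rule F)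
    also have "Im ((x + w * y) * cnj y) = Im (x * cnj y) + Im w * (cmod y)\<^sup>2"
      unfolding cmod_power2 by (simp add: power2_eq_square algebra_simps)
    finally show ?thesis using w \<sigma> by (auto simp: algebra_simps)
  qed
  moreover have "a * (c * w + e) - (a * w + b) * c = 1" using det by (simp add: algebra_simps)
  ultimately have "chart C' a (a * w + b) c (c * w + e) (- \<sigma>)"
    using O w \<sigma> O_intros by (auto simp: chart_def)
  then show ?thesis using that C' F oriented_bianchi_circle_iff_chart by blast
qed

text \<open>A line parallel to the real line has height in \<open>h * \<int>\<close>, so none fits strictly between the real
  line and its neighbour.\<close>
lemma separating_form:
  assumes disc: "(cmod B)\<^sup>2 - A * D = 1" and A: "A = 0" and D: "D = 2 * h * of_int k" and \<sigma>: "\<sigma> = 1 \<or> \<sigma> = (-1::real)"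
    and le: "\<And>t. herm A B D (of_real t) 1 \<le> 0" and ge: "herm A B D (of_real (- \<sigma> * h) * \<i>) 1 \<ge> 0"
  shows "D = 0 \<or> D = - 2 * h"
    and "herm A B D x y = - \<sigma> * (2 * Im (x * cnj y)) + D * (cmod y)\<^sup>2"
proof -
  have le': "2 * t * Re B + D \<le> 0" for t using le[of t] A by (simp add: herm_def mult_ac)
  have B0: "Re B = 0"
  proof (rule ccontr)
    assume "Re B \<noteq> 0"
    \<comment> \<open>This value of \<open>t\<close> brings the left-hand side of \<open>le'\<close>
      to 1.\<close>
    then have "2 * ((1 - D) / (2 * Re B)) * Re B = 1 - D" by simp
    then show False using le'[of "(1 - D) / (2 * Re B)"] by linarith
  qed
  have D0: "D \<le> 0" using le'[of 0] by simp
  have "(Im B)\<^sup>2 = 1" using disc A B0 by (simp add: cmod_power2)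
  then have "Im B = 1 \<or> Im B = -1" by (simp add: power2_eq_1_iff)
  moreover have ge': "2 * (\<sigma> * h * Im B) + D \<ge> 0" using ge A by (simp add: herm_def algebra_simps)
  ultimately have B1: "Im B = \<sigma>" using D0 h_pos \<sigma> by auto
  then have "\<sigma> * h * Im B = h" using \<sigma> by auto
  then have "2 * h + D \<ge> 0" using ge' by (simp only:)
  moreover have "2 * h * (of_int k + 1) = 2 * h + D" unfolding D by (simp add: algebra_simps)
  ultimately have "2 * h * (of_int k + 1) \<ge> 0" by simp
  then have "real_of_int k + 1 \<ge> 0" using h_pos by (simp add: zero_le_mult_iff)
  moreover have "real_of_int k \<le> 0" using D0 D h_pos by (simp add: mult_le_0_iff)
  ultimately have "k = 0 \<or> k = -1" by linarith
  then show "D = 0 \<or> D = - 2 * h" using D by auto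
  show "herm A B D x y = - \<sigma> * (2 * Im (x * cnj y)) + D * (cmod y)\<^sup>2"
    using A B0 B1 by (simp add: herm_def algebra_simps)
qed

text \<open>A point on the circle \<open>Q\<close> is a limit of points interior to
  \<open>Q\<close>, and the interior of \<open>C\<close> is open.\<close>

lemma interiors_meet_if_point_in_interior:
  assumes Q: "Q \<in> oriented_bianchi_circles K" and C: "wf_ocircle C"
    and xy: "form Q x y = 0" "form C x y > 0"
  shows "\<exists>u v. form Q u v > 0 \<and> form C u v > 0"
proof (rule ccontr)
  assume contra: "\<not> ?thesis"
  obtain a b c e \<sigma> where ch: "chart Q a b c e \<sigma>" using Q oriented_bianchi_circle_iff_chart by blast
  have det: "a * e - b * c = 1" and \<sigma>: "\<sigma> = 1 \<or> \<sigma> = -1" using ch by (auto simp: chart_def)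
  have F: "form Q (a * x + b * y) (c * x + e * y) = \<sigma> * (2 * Im (x * cnj y))" for x y
    using ch by (simp add: chart_def)
  obtain x' y' where xy': "x = a * x' + b * y'" "y = c * x' + e * y'" by (rule chart_coordinates[OF det])
  have "Im (x' * cnj y') = 0" using xy(1) F \<sigma> unfolding xy' by auto
  then obtain l s t where lst: "x' = l * of_real s" "y' = l * of_real t" by (rule real_ray)
  obtain A B D where f: "form C = herm A B D" using form_eq_herm[OF C] by metis
  have "form C x y = herm A B D (l * (a * s + b * t)) (l * (c * s + e * t))"
    unfolding f xy' lst by (simp add: algebra_simps)
  then have pos: "herm A B D (a * s + b * t) (c * s + e * t) > 0"
    using xy(2) unfolding herm_scale by (simp add: zero_less_mult_iff)
  then have st: "s \<noteq> 0 \<or> t \<noteq> 0" by (auto simp: herm_0_0)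
  \<comment> \<open>A direction into the interior of \<open>Q\<close>, transverse to the real vector
    \<open>(s, t)\<close> and valid for \<open>t = 0\<close>, that is, at infinity.\<close>
  define u v where "u = \<i> * of_real (\<sigma> * t)" and "v = - \<i> * of_real (\<sigma> * s)"
  have "herm A B D (a * s + b * t) (c * s + e * t) \<le> 0"
  proof (rule herm_nonpos_limit)
    fix \<epsilon> :: real assume "0 < \<epsilon>" "\<epsilon> < 1"
    have im: "Im ((of_real s + of_real \<epsilon> * u) * cnj (of_real t + of_real \<epsilon> * v)) = \<sigma> * (\<epsilon> * (s\<^sup>2 + t\<^sup>2))"
      by (simp add: u_def v_def power2_eq_square algebra_simps)
    have "\<epsilon> * (s\<^sup>2 + t\<^sup>2) > 0" using \<open>0 < \<epsilon>\<close> st by (simp add: sum_power2_gt_zero_iff)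
    then have "form Q (a * (of_real s + of_real \<epsilon> * u) + b * (of_real t + of_real \<epsilon> * v))
       (c * (of_real s + of_real \<epsilon> * u) + e * (of_real t + of_real \<epsilon> * v)) > 0"
      unfolding F im using \<sigma> by fastforce
    then have "form C (a * (of_real s + of_real \<epsilon> * u) + b * (of_real t + of_real \<epsilon> * v))
       (c * (of_real s + of_real \<epsilon> * u) + e * (of_real t + of_real \<epsilon> * v)) \<le> 0"
      using contra not_le by blast
    then show "herm A B D (a * s + b * t + of_real \<epsilon> * (a * u + b * v)) (c * s + e * t + of_real \<epsilon> * (c * u + e * v)) \<le> 0"
      unfolding f by (simp add: algebra_simps)
  qed simp
  then show False using pos by simp
qed

text \<open>The images of infinity and 0 under a chart are distinct points of the circle, so its
  intersection with itself is not a single point.\<close>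

lemma not_tangent_self:
  assumes C: "C \<in> oriented_bianchi_circles K" and eq: "points X = points C"
  shows "\<not> tangent C X"
proof
  assume "tangent C X"
  then obtain p where p: "points C = {p}" using eq by (auto simp: tangent_def)
  obtain a b c e \<sigma> where ch: "chart C a b c e \<sigma>" using C oriented_bianchi_circle_iff_chart by blast
  have det: "a * e - b * c = 1" using ch by (simp add: chart_def)
  have F: "form C (a * x + b * y) (c * x + e * y) = \<sigma> * (2 * Im (x * cnj y))" for x y
    using ch by (simp add: chart_def)
  have "a \<noteq> 0 \<or> c \<noteq> 0" "b \<noteq> 0 \<or> e \<noteq> 0" using det by auto
  then have "proj a c \<in> points C" "proj b e \<in> points C"
    using F[of 1 0] F[of 0 1] by (simp_all add: proj_in_points[OF bianchi_wf[OF C]])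
  then have "proj a c = proj b e" using p by simp
  then have "a * e = b * c" by (auto simp: proj_def field_simps split: if_splits)
  then show False using det by simp
qed

text \<open>Where both forms vanish, \<open>2 * h * (cmod y)\<^sup>2\<close> vanishes too, which
  leaves only the image of infinity.\<close>

lemma tangent_neighbour:
  assumes ch: "chart C a b c e \<sigma>" and wf: "wf_ocircle C" "wf_ocircle C'"
    and F': "\<And>x y. form C' (a * x + b * y) (c * x + e * y) = - \<sigma> * (2 * Im (x * cnj y)) - 2 * h * (cmod y)\<^sup>2"
  shows "tangent C C'"
proof -
  have det: "a * e - b * c = 1" and \<sigma>: "\<sigma> \<noteq> 0" using ch by (auto simp: chart_def)
  have F: "form C (a * x + b * y) (c * x + e * y) = \<sigma> * (2 * Im (x * cnj y))" for x y
    using ch by (simp add: chart_def)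
  have ac: "a \<noteq> 0 \<or> c \<noteq> 0" using det by auto
  have "points C \<inter> points C' = {proj a c}"
  proof (intro equalityI subsetI)
    fix p assume p: "p \<in> points C \<inter> points C'"
    obtain x y where xy: "p = proj x y" "x \<noteq> 0 \<or> y \<noteq> 0" by (rule proj_cases)
    obtain u v where uv: "x = a * u + b * v" "y = c * u + e * v" by (rule chart_coordinates[OF det])
    have "form C x y = 0" "form C' x y = 0" using p xy by (simp_all add: proj_in_points wf)
    then have "v = 0" using \<sigma> h_pos unfolding uv F F' by simp
    then have "x = u * a" "y = u * c" "u \<noteq> 0" using uv xy(2) by auto
    then show "p \<in> {proj a c}" using xy(1) proj_scale by simp
  next
    fix p assume "p \<in> {proj a c}"
    then show "p \<in> points C \<inter> points C'"
      using F[of 1 0] F'[of 1 0] by (simp add: proj_in_points[OF wf(1) ac] proj_in_points[OF wf(2) ac])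
  qed
  then show ?thesis by (auto simp: tangent_def)
qed

text \<open>Connectivity excludes the two orientations together: a first step from \<open>C\<close>
  towards \<open>X\<close> reaches a circle \<open>Y\<close> different from both. The interior of
  \<open>Y\<close> avoids both sides of \<open>C\<close>, so the form of \<open>C\<close> would
  vanish on a half-plane in the chart of \<open>Y\<close>.\<close>

lemma opposite_not_in_admissible:
  assumes P: "admissible K P" and C: "C \<in> P" and X: "X \<in> P" and opp: "\<And>x y. form X x y = - form C x y"
  shows False
proof -
  have B: "D \<in> oriented_bianchi_circles K" if "D \<in> P" for D using P that by (auto simp: admissible_def)
  note wf = bianchi_wf[OF B]
  have dis: "form D' x y \<le> 0" if "D \<in> P" "D' \<in> P" "D \<noteq> D'" "form D x y > 0" for D D' x y
    using P that interiors_disjoint_iff[OF wf wf, OF that(1,2)] by (auto simp: admissible_def pairwise_def)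
  have pts: "points X = points C" using points_eq_if_opposite wf C X opp by blast
  have "C \<noteq> X"
  proof
    assume "C = X"
    then have 0: "form C x y = 0" for x y using opp[of x y] by simp
    obtain A B D where f: "form C = herm A B D" "(cmod B)\<^sup>2 - A * D = 1"
      using form_eq_herm[OF wf[OF C]] by metis
    have "A = 0 \<and> B = 0 \<and> D = 0"
      by (rule herm_not_vanishing_on_halfplane[of 1]) (use 0 f in auto)
    then show False using f by simp
  qed
  moreover have "(C, X) \<in> {(X, Y). X \<in> P \<and> Y \<in> P \<and> tangent X Y}\<^sup>*"
    using P C X by (auto simp: admissible_def tangency_connected_def)
  ultimately obtain Y where Y: "Y \<in> P" "tangent C Y"
    by (auto elim: converse_rtranclE)
  have "Y \<noteq> C" "Y \<noteq> X" using Y not_tangent_self[OF B[OF C]] pts by auto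
  then have 0: "form C x y = 0" if "form Y x y > 0" for x y
    using dis[OF Y(1) C _ that] dis[OF Y(1) X _ that] opp[of x y] by simp
  obtain a b c e \<sigma> where ch: "chart Y a b c e \<sigma>" using B[OF Y(1)] oriented_bianchi_circle_iff_chart by blast
  have O: "a \<in> \<O>" "b \<in> \<O>" "c \<in> \<O>" "e \<in> \<O>" and det: "a * e - b * c = 1" and \<sigma>: "\<sigma> = 1 \<or> \<sigma> = -1"
    using ch by (auto simp: chart_def)
  have F: "form Y (a * x + b * y) (c * x + e * y) = \<sigma> * (2 * Im (x * cnj y))" for x y
    using ch by (simp add: chart_def)
  obtain A B D where f: "\<And>x y. form C (a * x + b * y) (c * x + e * y) = herm A B D x y" "(cmod B)\<^sup>2 - A * D = 1"
    using pullback_herm[OF B[OF C] O det] by metis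
  have "A = 0 \<and> B = 0 \<and> D = 0"
  proof (rule herm_not_vanishing_on_halfplane[OF \<sigma>])
    fix x :: complex assume "\<sigma> * Im x > 0"
    then show "herm A B D x 1 = 0" using 0 F[of x 1] f(1)[of x 1] by simp
  qed
  then show False using f by simp
qed

text \<open>It suffices that \<open>insert C' P\<close> is admissible. An overlap of interiors or a
  new straddling would yield a Bianchi form, up to sign, that is nonpositive on \<open>C\<close> and
  nonnegative on \<open>C'\<close>. By \<open>separating_form\<close> it is then the form of
  \<open>C\<close> reversed or of \<open>C'\<close>, and each case is contradictory.\<close>

lemma neighbour_in_packing:
  assumes K3: "K \<noteq> quadratic_field (- 3)" and pack: "apollonian_packing K P"
    and C: "C \<in> P" and ch: "chart C a b c e \<sigma>" and C': "C' \<in> oriented_bianchi_circles K"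
    and F': "\<And>x y. form C' (a * x + b * y) (c * x + e * y) = - \<sigma> * (2 * Im (x * cnj y)) - 2 * h * (cmod y)\<^sup>2"
  shows "C' \<in> P"
proof (rule ccontr)
  assume notin: "C' \<notin> P"
  have P: "admissible K P" using pack by (simp add: apollonian_packing_def)
  have B: "D \<in> oriented_bianchi_circles K" if "D \<in> P" for D using P that by (auto simp: admissible_def)
  note wf = bianchi_wf[OF B]
  note wf' = bianchi_wf[OF C']
  have dis: "form D' x y \<le> 0" if "D \<in> P" "D' \<in> P" "D \<noteq> D'" "form D x y > 0" for D D' x y
    using P that interiors_disjoint_iff[OF wf wf, OF that(1,2)] by (auto simp: admissible_def pairwise_def)
  have nostr: "\<not> (D \<in> P \<and> D' \<in> P \<and> form D x y = 0 \<and> form E x y > 0 \<and> form D' u v = 0 \<and> form E u v < 0)"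
    if "E \<in> oriented_bianchi_circles K" for E D D' x y u v
    using P that straddles_iff[of P E] wf bianchi_wf[OF that] unfolding admissible_def by blast
  have O: "a \<in> \<O>" "b \<in> \<O>" "c \<in> \<O>" "e \<in> \<O>" and det: "a * e - b * c = 1" and \<sigma>: "\<sigma> = 1 \<or> \<sigma> = -1"
    using ch by (auto simp: chart_def)
  have F: "form C (a * x + b * y) (c * x + e * y) = \<sigma> * (2 * Im (x * cnj y))" for x y
    using ch by (simp add: chart_def)
  have coords: "\<exists>x' y'. x = a * x' + b * y' \<and> y = c * x' + e * y'" for x y
    using chart_coordinates[OF det] by metis
  have noopp: False if "X \<in> P" "\<And>x y. form X (a * x + b * y) (c * x + e * y) = - \<sigma> * (2 * Im (x * cnj y))" for X
  proof (rule opposite_not_in_admissible[OF P C that(1)])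
    fix x y
    obtain x' y' where "x = a * x' + b * y'" "y = c * x' + e * y'" using coords by blast
    then show "form X x y = - form C x y" using that(2)[of x' y'] F[of x' y'] by simp
  qed
  have same: "X = C'" if "wf_ocircle X" "\<And>x y. form X (a * x + b * y) (c * x + e * y) = - \<sigma> * (2 * Im (x * cnj y)) - 2 * h * (cmod y)\<^sup>2" for X
  proof (rule form_inj[OF that(1) wf'], intro ext)
    fix x y
    obtain x' y' where "x = a * x' + b * y'" "y = c * x' + e * y'" using coords by blast
    then show "form X x y = form C' x y" using that(2)[of x' y'] F'[of x' y'] by simp
  qed
  \<comment> \<open>Otherwise \<open>D\<close> engulfs the interior of \<open>C'\<close> while missing that of \<open>C\<close>, so it separates them.\<close>
  have disjoint: "form D x y \<le> 0" if D: "D \<in> P" and pos: "form C' x y > 0" for D x y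
  proof (rule ccontr)
    assume "\<not> form D x y \<le> 0"
    then have Dpos: "form D x y > 0" by simp
    obtain x' y' where xy: "x = a * x' + b * y'" "y = c * x' + e * y'" using coords by blast
    obtain A B' D' k where G: "\<And>x y. form D (a * x + b * y) (c * x + e * y) = herm A B' D' x y"
      "(cmod B')\<^sup>2 - A * D' = 1" "D' = 2 * h * of_int k"
      using pullback_herm[OF B[OF D] O det] by metis
    have pos': "- \<sigma> * (2 * Im (x' * cnj y')) - 2 * h * (cmod y')\<^sup>2 > 0" using pos unfolding xy F' .
    have Gpos: "herm A B' D' x' y' > 0" using Dpos unfolding xy G(1) .
    have "D \<noteq> C"
    proof
      assume "D = C"
      then have "\<sigma> * (2 * Im (x' * cnj y')) > 0" using Dpos unfolding xy by (simp add: F)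
      moreover have "2 * h * (cmod y')\<^sup>2 \<ge> 0" using h_pos by simp
      ultimately show False using pos' by linarith
    qed
    then have Gneg: "herm A B' D' x y \<le> 0" if "\<sigma> * (2 * Im (x * cnj y)) > 0" for x y
      using dis[OF C D, of "a * x + b * y" "c * x + e * y"] that \<open>D \<noteq> C\<close> unfolding F G(1) by blast
    \<comment> \<open>Otherwise \<open>D\<close> would have a point inside \<open>C'\<close>, while
      \<open>C\<close> passes outside \<open>C'\<close> at the image of 0, where the form of
      \<open>C'\<close> equals \<open>- 2 * h\<close>; so \<open>P\<close> would straddle
      \<open>C'\<close>.\<close>
    have G0: "herm A B' D' x y \<noteq> 0" if "- \<sigma> * (2 * Im (x * cnj y)) - 2 * h * (cmod y)\<^sup>2 > 0" for x y
      using nostr[OF C', of D C "a * x + b * y" "c * x + e * y" "a * 0 + b * 1" "c * 0 + e * 1"] D C that h_pos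
      unfolding F F' G(1) by simp
    have Im_y: "Im (x * cnj y) = Im (x / y) * (cmod y)\<^sup>2" if "y \<noteq> 0" for x y
      unfolding complex_div_cnj[of x y] using that by (simp only: Im_divide_of_real flip: of_real_power) simp
    have half: "y \<noteq> 0 \<and> - \<sigma> * Im (x / y) > h" if "- \<sigma> * (2 * Im (x * cnj y)) - 2 * h * (cmod y)\<^sup>2 > 0" for x y
    proof (cases "y = 0")
      case False
      have "- \<sigma> * (2 * (Im (x / y) * (cmod y)\<^sup>2)) - 2 * h * (cmod y)\<^sup>2 > 0"
        using that unfolding Im_y[OF False] .
      also have "- \<sigma> * (2 * (Im (x / y) * (cmod y)\<^sup>2)) - 2 * h * (cmod y)\<^sup>2 = 2 * (cmod y)\<^sup>2 * (- \<sigma> * Im (x / y) - h)"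
        by (simp add: algebra_simps)
      finally have "2 * (cmod y)\<^sup>2 * (- \<sigma> * Im (x / y) - h) > 0" .
      then show ?thesis using False by (simp add: zero_less_mult_iff)
    qed (use that in simp)
    have scale: "herm A B' D' x y = (cmod y)\<^sup>2 * herm A B' D' (x / y) 1" if "y \<noteq> 0" for x y
      using herm_scale[of A B' D' y "x / y" 1] that by simp
    have Gpos': "herm A B' D' x y > 0" if xy: "- \<sigma> * (2 * Im (x * cnj y)) - 2 * h * (cmod y)\<^sup>2 > 0" for x y
    proof -
      have "herm A B' D' (x / y) 1 > 0"
      proof (rule herm_halfplane_sign[where \<sigma> = "- \<sigma>" and h = h and x\<^sub>0 = "x' / y'"])
        show "herm A B' D' x 1 \<noteq> 0" if "- \<sigma> * Im x > h" for x using G0[of x 1] that by simp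
        show "- \<sigma> * Im (x' / y') > h" "- \<sigma> * Im (x / y) > h" using half pos' xy by blast+
        show "herm A B' D' (x' / y') 1 > 0" using Gpos scale[where x = x' and y = y'] half[OF pos'] by (simp add: zero_less_mult_iff)
      qed
      then show ?thesis using scale[where x = x and y = y] half[OF xy] by (simp add: zero_less_mult_iff)
    qed
    have "herm A B' D' 1 0 \<le> 0"
    proof (rule herm_nonpos_limit[where \<eta> = 1 and u = 0 and v = "of_real (- \<sigma>) * \<i>"])
      fix \<epsilon> :: real assume "0 < \<epsilon>"
      then show "herm A B' D' (1 + of_real \<epsilon> * 0) (0 + of_real \<epsilon> * (of_real (- \<sigma>) * \<i>)) \<le> 0"
        using \<sigma> by (intro Gneg) auto
    qed simp
    moreover have "herm A B' D' 1 0 \<ge> 0"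
    \<comment> \<open>The approach to infinity stays in the half-plane inside \<open>C'\<close>
      exactly while \<open>1 / \<epsilon>\<close> exceeds \<open>h\<close>.\<close>
    proof (rule herm_nonneg_limit[where \<eta> = "1 / h" and u = 0 and v = "of_real \<sigma> * \<i>"])
      fix \<epsilon> :: real assume \<epsilon>: "0 < \<epsilon>" "\<epsilon> < 1 / h"
      then have "\<epsilon> * (1 - h * \<epsilon>) > 0" using h_pos by (simp add: field_simps)
      then have "2 * \<epsilon> - 2 * h * \<epsilon>\<^sup>2 > 0" by (simp add: power2_eq_square algebra_simps)
      then show "herm A B' D' (1 + of_real \<epsilon> * 0) (0 + of_real \<epsilon> * (of_real \<sigma> * \<i>)) \<ge> 0"
        using \<sigma> by (intro less_imp_le Gpos') (auto simp: norm_mult)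
    qed (use h_pos in simp)
    ultimately have A0: "A = 0" by (simp add: herm_def)
    have le: "herm A B' D' (of_real t) 1 \<le> 0" for t
    proof (rule herm_nonpos_limit[where \<eta> = 1 and v = 0 and u = "of_real \<sigma> * \<i>"])
      fix \<epsilon> :: real assume "0 < \<epsilon>"
      then show "herm A B' D' (of_real t + of_real \<epsilon> * (of_real \<sigma> * \<i>)) (1 + of_real \<epsilon> * 0) \<le> 0"
        using \<sigma> by (intro Gneg) auto
    qed simp
    have ge: "herm A B' D' (of_real (- \<sigma> * h) * \<i>) 1 \<ge> 0"
    proof (rule herm_nonneg_limit[where \<eta> = 1 and v = 0 and u = "of_real (- \<sigma>) * \<i>"])
      fix \<epsilon> :: real assume "0 < \<epsilon>"
      then show "herm A B' D' (of_real (- \<sigma> * h) * \<i> + of_real \<epsilon> * (of_real (- \<sigma>) * \<i>)) (1 + of_real \<epsilon> * 0) \<ge> 0"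
        using \<sigma> by (intro less_imp_le Gpos') auto
    qed simp
    note sep = separating_form[OF G(2) A0 G(3) \<sigma> le ge]
    from sep(1) show False
    proof
      assume "D' = 0"
      then have "form D (a * x + b * y) (c * x + e * y) = - \<sigma> * (2 * Im (x * cnj y))" for x y
        unfolding G(1) sep(2) by simp
      then show False by (rule noopp[OF D])
    next
      assume "D' = - 2 * h"
      then have "form D (a * x + b * y) (c * x + e * y) = - \<sigma> * (2 * Im (x * cnj y)) - 2 * h * (cmod y)\<^sup>2" for x y
        unfolding G(1) sep(2) by simp
      then show False using same[OF wf[OF D]] D notin by blast
    qed
  qed
  \<comment> \<open>The sign \<open>\<epsilon>\<close> treats both orientations of \<open>E\<close> at once: if \<open>E\<close> had \<open>C'\<close> on one side and \<open>P\<close>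
    on the other, it would separate \<open>C'\<close> from \<open>C\<close>.\<close>
  have nostr': False
    if E: "E \<in> oriented_bianchi_circles K" and \<epsilon>: "\<epsilon> = 1 \<or> \<epsilon> = (-1::real)" and Q: "Q \<in> P"
      and pos: "form C' x y = 0" "\<epsilon> * form E x y > 0" and neg: "form Q u v = 0" "\<epsilon> * form E u v < 0"
    for E \<epsilon> Q x y u v
  proof -
    \<comment> \<open>\<open>P\<close> does not straddle \<open>E\<close>, so the position of
      \<open>Q\<close> fixes the side of all of \<open>P\<close>; non-crossing then places all of
      \<open>C'\<close> on the other side.\<close>
    have PE: "\<epsilon> * form E x y \<le> 0" if "D \<in> P" "form D x y = 0" for D x y
      using nostr[OF E, of D Q x y u v] nostr[OF E, of Q D u v x y] that Q \<epsilon> neg by force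
    have CE: "\<epsilon> * form E z w \<ge> 0" if "form C' z w = 0" for z w
      using no_crossing[OF K3 C' E, of x y z w] no_crossing[OF K3 C' E, of z w x y] pos that \<epsilon> by force
    obtain A B' D' k where G: "\<And>x y. form E (a * x + b * y) (c * x + e * y) = herm A B' D' x y"
      "(cmod B')\<^sup>2 - A * D' = 1" "D' = 2 * h * of_int k"
      using pullback_herm[OF E O det] by metis
    have \<epsilon>G: "\<epsilon> * form E (a * x + b * y) (c * x + e * y) = herm (\<epsilon> * A) (of_real \<epsilon> * B') (\<epsilon> * D') x y" for x y
      unfolding G(1) using \<epsilon> herm_uminus by auto
    have disc: "(cmod (of_real \<epsilon> * B'))\<^sup>2 - \<epsilon> * A * (\<epsilon> * D') = 1" using G(2) \<epsilon> by (auto simp: norm_mult)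
    obtain k' :: int where D': "\<epsilon> * D' = 2 * h * of_int k'"
      using G(3) \<epsilon> by (metis mult_1 mult_minus1 mult_minus_right of_int_minus)
    have le: "herm (\<epsilon> * A) (of_real \<epsilon> * B') (\<epsilon> * D') x y \<le> 0" if "Im (x * cnj y) = 0" for x y
      using PE[OF C, of "a * x + b * y" "c * x + e * y"] that unfolding F \<epsilon>G by simp
    have ge: "herm (\<epsilon> * A) (of_real \<epsilon> * B') (\<epsilon> * D') x y \<ge> 0"
      if "- \<sigma> * (2 * Im (x * cnj y)) - 2 * h * (cmod y)\<^sup>2 = 0" for x y
      using CE[of "a * x + b * y" "c * x + e * y"] that unfolding F' \<epsilon>G by simp
    \<comment> \<open>Infinity, the point of tangency in the chart, lies on both circles, so both
      inequalities apply there.\<close>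
    have A0: "\<epsilon> * A = 0" using le[of 1 0] ge[of 1 0] by (simp add: herm_def)
    have "herm (\<epsilon> * A) (of_real \<epsilon> * B') (\<epsilon> * D') (of_real t) 1 \<le> 0" for t by (rule le) simp
    moreover have "herm (\<epsilon> * A) (of_real \<epsilon> * B') (\<epsilon> * D') (of_real (- \<sigma> * h) * \<i>) 1 \<ge> 0"
      by (rule ge) (use \<sigma> in auto)
    ultimately have sep: "\<epsilon> * D' = 0 \<or> \<epsilon> * D' = - 2 * h"
      "\<And>x y. herm (\<epsilon> * A) (of_real \<epsilon> * B') (\<epsilon> * D') x y = - \<sigma> * (2 * Im (x * cnj y)) + \<epsilon> * D' * (cmod y)\<^sup>2"
      using separating_form[OF disc A0 D' \<sigma>] by blast+
    from sep(1) show False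
    proof
      assume 0: "\<epsilon> * D' = 0"
      obtain u' v' where uv: "u = a * u' + b * v'" "v = c * u' + e * v'" using coords by blast
      \<comment> \<open>The strict sign at a point of \<open>Q\<close> places that point inside
        \<open>C\<close>, so the interiors of \<open>Q\<close> and \<open>C\<close> would
        overlap.\<close>
      have "form C u v = - (\<epsilon> * form E u v)" using sep(2)[of u' v'] unfolding uv F \<epsilon>G 0 by simp
      then have Cuv: "form C u v > 0" using neg(2) by simp
      then have "Q \<noteq> C" using neg(1) by auto
      then show False
        using interiors_meet_if_point_in_interior[OF B[OF Q] wf[OF C] neg(1) Cuv] dis[OF Q C] not_le by blast
    next
      assume 0: "\<epsilon> * D' = - 2 * h"
      obtain x' y' where xy: "x = a * x' + b * y'" "y = c * x' + e * y'" using coords by blast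
      have "\<epsilon> * form E x y = form C' x y" using sep(2)[of x' y'] unfolding xy F' \<epsilon>G 0 by simp
      then show False using pos by linarith
    qed
  qed
  have "admissible K (insert C' P)"
    unfolding admissible_def
  proof (intro conjI ballI)
    show "insert C' P \<subseteq> oriented_bianchi_circles K" using B C' by blast
    define R where "R = {(X, Y). X \<in> insert C' P \<and> Y \<in> insert C' P \<and> tangent X Y}"
    have "tangent C C'" by (rule tangent_neighbour[OF ch wf[OF C] wf' F'])
    then have CC': "(C, C') \<in> R" "(C', C) \<in> R" using C by (auto simp: R_def tangent_def Int_commute)
    have "{(X, Y). X \<in> P \<and> Y \<in> P \<and> tangent X Y}\<^sup>* \<subseteq> R\<^sup>*" by (rule rtrancl_mono) (auto simp: R_def)
    then have PP: "(X, Y) \<in> R\<^sup>*" if "X \<in> P" "Y \<in> P" for X Y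
      using P that by (auto simp: admissible_def tangency_connected_def)
    have toC: "(X, C) \<in> R\<^sup>*" "(C, X) \<in> R\<^sup>*" if "X \<in> insert C' P" for X
      using that PP C CC' by auto
    then show "tangency_connected (insert C' P)"
      unfolding tangency_connected_def R_def[symmetric] by (meson rtrancl_trans)
    have "oc_interior C' \<inter> oc_interior D = {}" if "D \<in> P" for D
      using disjoint[OF that] interiors_disjoint_iff[OF wf' wf[OF that]] by blast
    moreover have "pairwise (\<lambda>C D. oc_interior C \<inter> oc_interior D = {}) P"
      using P by (simp add: admissible_def)
    ultimately show "pairwise (\<lambda>C D. oc_interior C \<inter> oc_interior D = {}) (insert C' P)"
      by (auto simp: pairwise_insert Int_commute)
    fix E assume E: "E \<in> oriented_bianchi_circles K"
    show "\<not> straddles (insert C' P) E"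
    proof
      assume "straddles (insert C' P) E"
      then obtain D D' x y u v where *: "D \<in> insert C' P" "D' \<in> insert C' P"
        "form D x y = 0" "form E x y > 0" "form D' u v = 0" "form E u v < 0"
        using straddles_iff[of "insert C' P" E] wf wf' bianchi_wf[OF E] by blast
      consider "D \<in> P" "D' \<in> P" | "D = C'" "D' \<in> P" | "D \<in> P" "D' = C'" | "D = C'" "D' = C'"
        using * by blast
      then show False
      proof cases
        case 1
        then show False using nostr[OF E] * by blast
      next
        case 2
        then show False using nostr'[OF E, of 1 D' x y u v] * by simp
      next
        case 3
        then show False using nostr'[OF E, of "-1" D u v x y] * by simp
      next
        case 4
        then show False using no_crossing[OF K3 C' E] * by blast
      qed
    qed
  qed
  then have "insert C' P = P" using pack unfolding apollonian_packing_def by blast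
  then show False using notin by blast
qed

text \<open>The empty collection is not maximal: the real line alone is admissible, since by
  non-crossing a single Bianchi circle straddles no other.\<close>

lemma packing_nonempty:
  assumes K3: "K \<noteq> quadratic_field (- 3)" and pack: "apollonian_packing K P"
  shows "P \<noteq> {}"
proof
  assume "P = {}"
  define L where "L = Line 1 0"
  have "chart L 1 0 0 1 1" using O_0 O_1 by (simp add: chart_def L_def herm_def)
  then have L: "L \<in> oriented_bianchi_circles K"
    unfolding oriented_bianchi_circle_iff_chart by (metis L_def wf_ocircle.simps(2) norm_one)
  have "\<not> straddles {L} E" if "E \<in> oriented_bianchi_circles K" for E
    using straddles_iff[of "{L}" E] bianchi_wf that L no_crossing[OF K3 L that] by auto
  then have "admissible K {L}"
    using L by (simp add: admissible_def tangency_connected_def)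
  then show False using pack \<open>P = {}\<close> unfolding apollonian_packing_def by blast
qed

section \<open>The greatest common divisor of the reduced curvatures\<close>

lemma Gcd_reduced_curvature:
  assumes K3: "K \<noteq> quadratic_field (- 3)" and pack: "apollonian_packing K P"
  shows "Gcd (reduced_curvature (discriminant K) ` P) = 1"
proof -
  define n where "n = reduced_curvature (discriminant K)"
  define g where "g = Gcd (n ` P)"
  have B: "D \<in> oriented_bianchi_circles K" if "D \<in> P" for D
    using pack that by (auto simp: apollonian_packing_def admissible_def)
  obtain C where C: "C \<in> P" using packing_nonempty[OF assms] by blast
  have norm: "\<exists>k. (cmod c)\<^sup>2 = of_int (g * k)" if ch: "chart C a b c e \<sigma>" for a b c e \<sigma>
  proof -
    obtain C' where C': "C' \<in> oriented_bianchi_circles K"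
      and F': "\<And>x y. form C' (a * x + b * y) (c * x + e * y) = - \<sigma> * (2 * Im (x * cnj y)) - 2 * h * (cmod y)\<^sup>2"
      using ex_neighbour[OF ch] by blast
    have "C' \<in> P" by (rule neighbour_in_packing[OF K3 pack C ch C' F'])
    then have "g dvd n C + n C'" using C by (simp add: g_def Gcd_dvd)
    then obtain k where k: "n C + n C' = g * k" by (elim dvdE)
    have det: "a * e - b * c = 1" using ch by (simp add: chart_def)
    have F: "form C (a * x + b * y) (c * x + e * y) = \<sigma> * (2 * Im (x * cnj y))" for x y
      using ch by (simp add: chart_def)
    \<comment> \<open>The vector \<open>(1, 0)\<close> has chart coordinates
      \<open>(e, - c)\<close>; the two imaginary-part terms cancel and only the height term of
      \<open>C'\<close> survives.\<close>
    have "form C 1 0 + form C' 1 0 = form C (a * e + b * (- c)) (c * e + e * (- c)) + form C' (a * e + b * (- c)) (c * e + e * (- c))"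
      using det by (simp add: mult.commute)
    also have "\<dots> = - 2 * h * (cmod c)\<^sup>2" unfolding F F' by simp
    finally have "curvature C + curvature C' = 2 * h * (cmod c)\<^sup>2"
      by (simp add: curvature_eq_form bianchi_wf B C C')
    then have "2 * h * of_int (n C + n C') = 2 * h * (cmod c)\<^sup>2"
      using reduced_curvature_eq[OF B[OF C]] reduced_curvature_eq[OF C'] by (simp add: n_def algebra_simps)
    then have "(cmod c)\<^sup>2 = of_int (n C + n C')" using h_pos by simp
    then show ?thesis unfolding k by blast
  qed
  obtain a b c e \<sigma> where ch: "chart C a b c e \<sigma>" using B[OF C] oriented_bianchi_circle_iff_chart by blast
  obtain k1 where "(cmod c)\<^sup>2 = of_int (g * k1)" using norm[OF ch] by blast
  moreover obtain k2 where "(cmod e)\<^sup>2 = of_int (g * k2)" using norm[OF chart_S[OF ch]] by blast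
  moreover obtain k3 where "(cmod (c + e))\<^sup>2 = of_int (g * k3)" using norm[OF chart_T[OF ch]] by blast
  ultimately have "g dvd 1"
    using ch by (intro bottom_row_norms_coprime[of a b c e g k1 k2 k3]) (auto simp: chart_def)
  moreover have "g \<ge> 0" by (simp add: g_def)
  ultimately show ?thesis by (simp add: g_def n_def)
qed

end

theorem theorem16p1:
  fixes K :: "complex set" and \<Delta> :: int and P :: "ocircle set"
  assumes "imaginary_quadratic_field K"
    and "K \<noteq> quadratic_field (- 3)"
    and "\<Delta> = discriminant K"
    and "apollonian_packing K P"
  shows "Gcd (reduced_curvature \<Delta> ` P) = 1"
proof -
  obtain d where "d < 0" "K = quadratic_field d"
    using assms(1) by (auto simp: imaginary_quadratic_field_def)
  then interpret imaginary_quadratic d K by unfold_locales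
  show ?thesis using Gcd_reduced_curvature assms by simp
qed

end
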